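(* Suppose $\Omega\subset\mathbb{C}^d$ is a $\mathbb{C}$-properly convex domain and every domain in $\overline{\mathrm{Aff}(\mathbb{C}^d)\cdot\Omega}\cap\mathbb{X}_d$ has simple boundary. Assume $\sigma_n:[a_n,b_n]\to\Omega$ is a sequence of geodesics in $(\Omega,K_\Omega)$ such that $$\lim_{n\to\infty}\sigma_n(a_n)=\xi\in\overline{\Omega}^{\mathrm{End}}\quad\text{and}\quad\lim_{n\to\infty}\sigma_n(b_n)=\eta\in\overline{\Omega}^{\mathrm{End}}.$$ If $\xi\ne\eta$, then there exist sequences $n_j\to\infty$ and $T_j\in[a_{n_j},b_{n_j}]$ such that $\sigma_{n_j}(T_j)$ converges to a point in $\Omega$.
   Context: A convex domain in $\mathbb{C}^d$ is $\mathbb{C}$-properly convex if it contains no entire complex affine line; on such a domain the Kobayashi pseudo-distance $K_\Omega$ is a genuine distance. A geodesic in $(\Omega,K_\Omega)$ is a map $\sigma:I\to\Omega$ from an interval with $K_\Omega(\sigma(s),\sigma(t))=|s-t|$ for all $s,t\in I$. $\overline{\Omega}^{\mathrm{End}}$ denotes the (Freudenthal) end compactification of the Euclidean closure $\overline{\Omega}$. $\mathbb{X}_d$ is the set of all non-empty $\mathbb{C}$-properly convex domains in $\mathbb{C}^d$, with the local Hausdorff topology: $\Omega_n\to\Omega$ in $\mathbb{X}_d$ if there is $R_0\ge0$ such that for all $R\ge R_0$ the Hausdorff distance between $\overline{\Omega}_n\cap\overline{B(0;R)}$ and $\overline{\Omega}\cap\overline{B(0;R)}$ tends to $0$, where $B(0;R)$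 is the Euclidean ball (the Hausdorff distance between the empty set and a non-empty set is $\infty$). $\mathrm{Aff}(\mathbb{C}^d)$ is the group of complex affine automorphisms of $\mathbb{C}^d$; $\overline{\mathrm{Aff}(\mathbb{C}^d)\cdot\Omega}\cap\mathbb{X}_d$ is the set of all $\mathcal{D}\in\mathbb{X}_d$ for which there are $A_n\in\mathrm{Aff}(\mathbb{C}^d)$ with $A_n\Omega\to\mathcal{D}$ in $\mathbb{X}_d$. A domain has simple boundary if every holomorphic map from the unit disk $\mathbb{D}\subset\mathbb{C}$ into its boundary is constant. *)

theory Defs
  imports "HOL-Complex_Analysis.Complex_Analysis"
begin

definition properly_convex_domains :: "(complex ^ 'd) set set" where
  "properly_convex_domains =
     {\<Omega>. \<Omega> \<noteq> {} \<and> open \<Omega> \<and> convex \<Omega> \<and>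
         \<not> (\<exists>p v. v \<noteq> 0 \<and> (\<forall>z :: complex. p + z *s v \<in> \<Omega>))}"

definition holomorphic_disc :: "(complex \<Rightarrow> complex ^ 'd) \<Rightarrow> (complex ^ 'd) set \<Rightarrow> bool" where
  "holomorphic_disc f S \<longleftrightarrow>
     (\<forall>i. (\<lambda>z. f z $ i) holomorphic_on ball 0 1) \<and> f ` ball 0 1 \<subseteq> S"

definition poincare_dist :: "complex \<Rightarrow> complex \<Rightarrow> real" where
  "poincare_dist z w = artanh (cmod ((z - w) / (1 - cnj w * z)))"

text \<open>
  Kobayashi's definition: the infimum over finite chains of holomorphic discs joining \<open>x\<close> to \<open>y\<close>
  of the total Poincare length, the Poincare metric being \<open>|dz| / (1 - |z|^2)\<close>.
\<close>

definition kobayashi_dist :: "(complex ^ 'd) set \<Rightarrow> complex ^ 'd \<Rightarrow> complex ^ 'd \<Rightarrow> real" where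
  "kobayashi_dist \<Omega> x y =
     Inf {\<Sum>i<m. poincare_dist (\<alpha> i) (\<beta> i) | (m :: nat) p f \<alpha> \<beta>.
            p 0 = x \<and> p m = y \<and>
            (\<forall>i<m. holomorphic_disc (f i) \<Omega> \<and> \<alpha> i \<in> ball 0 1 \<and> \<beta> i \<in> ball 0 1 \<and>
                   f i (\<alpha> i) = p i \<and> f i (\<beta> i) = p (Suc i))}"

definition kobayashi_geodesic :: "(complex ^ 'd) set \<Rightarrow> real set \<Rightarrow> (real \<Rightarrow> complex ^ 'd) \<Rightarrow> bool" where
  "kobayashi_geodesic \<Omega> I \<sigma> \<longleftrightarrow>
     \<sigma> ` I \<subseteq> \<Omega> \<and> (\<forall>s\<in>I. \<forall>t\<in>I. kobayashi_dist \<Omega> (\<sigma> s) (\<sigma> t) = \<bar>s - t\<bar>)"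

definition simple_boundary :: "(complex ^ 'd) set \<Rightarrow> bool" where
  "simple_boundary \<Omega> \<longleftrightarrow>
     (\<forall>\<phi>. holomorphic_disc \<phi> (frontier \<Omega>) \<longrightarrow> \<phi> constant_on ball 0 1)"

text \<open>
  In \<open>ennreal\<close> an empty infimum is \<open>\<infinity>\<close> and an empty supremum is \<open>0\<close>, so the distance between the
  empty set and a non-empty set is \<open>\<infinity>\<close>, and that between the empty set and itself is \<open>0\<close>.
\<close>

definition hausdorff_dist :: "'a::metric_space set \<Rightarrow> 'a set \<Rightarrow> ennreal" where
  "hausdorff_dist A B =
     max (SUP a\<in>A. INF b\<in>B. ennreal (dist a b)) (SUP b\<in>B. INF a\<in>A. ennreal (dist a b))"

definition local_hausdorff_tendsto ::
    "(nat \<Rightarrow> 'a::real_normed_vector set) \<Rightarrow> 'a set \<Rightarrow> bool" where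
  "local_hausdorff_tendsto U V \<longleftrightarrow>
     (\<exists>R\<^sub>0\<ge>0. \<forall>R\<ge>R\<^sub>0.
        (\<lambda>n. hausdorff_dist (closure (U n) \<inter> closure (ball 0 R)) (closure V \<inter> closure (ball 0 R)))
          \<longlonglongrightarrow> 0)"

definition affine_automorphisms :: "(complex ^ 'd \<Rightarrow> complex ^ 'd) set" where
  "affine_automorphisms = {\<lambda>z. M *v z + b | (M :: complex ^ 'd ^ 'd) b. invertible M}"

definition affine_orbit_closure :: "(complex ^ 'd) set \<Rightarrow> (complex ^ 'd) set set" where
  "affine_orbit_closure \<Omega> =
     {D \<in> properly_convex_domains.
        \<exists>A. (\<forall>n. A n \<in> affine_automorphisms) \<and> local_hausdorff_tendsto (\<lambda>n. A n ` \<Omega>) D}"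

text \<open>
  The ends of \<open>X\<close> form the inverse limit, over the compact \<open>K \<subseteq> X\<close>, of the sets of components of
  \<open>X - K\<close>. A coherent choice never selects a relatively compact component: enlarging \<open>K\<close> by its
  closure would leave nothing to choose inside it.
\<close>

definition space_ends :: "'a::topological_space set \<Rightarrow> ('a set \<Rightarrow> 'a set) set" where
  "space_ends X =
     {e \<in> (\<Pi>\<^sub>E K\<in>{K. compact K \<and> K \<subseteq> X}. components (X - K)).
        \<forall>K L. compact K \<and> compact L \<and> K \<subseteq> L \<and> L \<subseteq> X \<longrightarrow> e L \<subseteq> e K}"

text \<open>
  The Freudenthal compactification consists of the points \<open>Inl x\<close> of \<open>X\<close> and the ends \<open>Inr e\<close>. An end
  \<open>e\<close> has as basic neighbourhoods, for \<open>K\<close> compact, the component \<open>e K\<close> together with all ends that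
  choose the same component at \<open>K\<close>. This is the usual topology for \<open>X\<close> locally compact, Hausdorff
  and locally connected, as is every closed convex set in Euclidean space.
\<close>

definition end_compactification ::
    "'a::topological_space set \<Rightarrow> ('a + ('a set \<Rightarrow> 'a set)) topology" where
  "end_compactification X =
     topology_generated_by
       ({Inl ` V | V. openin (top_of_set X) V} \<union>
        {Inl ` C \<union> Inr ` {e \<in> space_ends X. e K = C} | K C.
           compact K \<and> K \<subseteq> X \<and> C \<in> components (X - K)})"

lemma topspace_end_compactification:
  fixes X :: "'a::topological_space set"
  shows "topspace (end_compactification X) = Inl ` X \<union> Inr ` space_ends X"
proof (intro equalityI subsetI)
  fix x assume "x \<in> topspace (end_compactification X)"
  then consider V where "openin (top_of_set X) V" "x \<in> Inl ` V"
    | K C where "C \<in> components (X - K)" "x \<in> Inl ` C \<union> Inr ` {e \<in> space_ends X. e K = C}"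
    unfolding end_compactification_def topology_generated_by_topspace by auto
  then show "x \<in> Inl ` X \<union> Inr ` space_ends X"
  proof cases
    case 1
    then show ?thesis using openin_subset[of "top_of_set X" V] by auto
  next
    case 2
    then show ?thesis using in_components_subset[of C "X - K"] by auto
  qed
next
  fix x assume "x \<in> Inl ` X \<union> Inr ` space_ends X"
  then consider "x \<in> Inl ` X" | e where "e \<in> space_ends X" "x = Inr e" by auto
  then show "x \<in> topspace (end_compactification X)"
  proof cases
    case 1
    have "(Inl ` X :: ('a + ('a set \<Rightarrow> 'a set)) set) \<in> {Inl ` V | V. openin (top_of_set X) V}"
      using openin_subtopology_self by blast
    then show ?thesis
      unfolding end_compactification_def topology_generated_by_topspace
      using 1 by (intro UnionI[OF UnI1])
  next
    case 2
    let ?B = "Inl ` e {} \<union> Inr ` {e' \<in> space_ends X. e' {} = e {}}"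
    have "e {} \<in> components (X - {})"
      using 2(1) unfolding space_ends_def
      by (intro PiE_mem[of e "{K. compact K \<and> K \<subseteq> X}" "\<lambda>K. components (X - K)" "{}"]) simp_all
    then have "?B \<in> {Inl ` C \<union> Inr ` {e \<in> space_ends X. e K = C} | K C.
           compact K \<and> K \<subseteq> X \<and> C \<in> components (X - K)}"
      using compact_empty empty_subsetI by (intro CollectI exI[of _ "{}"] exI[of _ "e {}"]) simp
    moreover have "x \<in> ?B"
      using 2 by simp
    ultimately show ?thesis
      unfolding end_compactification_def topology_generated_by_topspace
      by (intro UnionI[OF UnI2])
  qed
qed

end

theory Submission
  imports Defs
begin

text \<open>
  Call \<open>v\<close> a disc direction at \<open>z\<close> if the closed affine disc with centre \<open>z\<close> and radius vector \<open>v\<close>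
  lies in \<open>\<Omega>\<close>. Fix \<open>p \<in> \<Omega>\<close>. If moving from a boundary point towards \<open>p\<close> by a large factor \<open>L\<close> did
  not double the disc directions, then rescaling \<open>\<Omega>\<close> by complex affine maps would give a limit domain
  with a disc in its boundary. Iterating the doubling, disc directions at \<open>z\<close> are bounded by a power of
  the boundary distance \<open>\<delta>(z)\<close>, locally uniformly.

  By separation with half planes, two points at Kobayashi distance at most \<open>1\<close> differ by a bounded
  multiple of a disc direction. Along a geodesic in a bounded region, let \<open>\<delta>\<close> be maximal at time \<open>t\<^sub>0\<close>.
  Since the Kobayashi distance to \<open>p\<close> grows at most logarithmically in \<open>1/\<delta>\<close>, the value of \<open>\<delta>\<close>
  decays exponentially away from \<open>t\<^sub>0\<close>. Summing over unit steps bounds the Euclidean distance of the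
  end points by a power of the maximum of \<open>\<delta>\<close>. Hence geodesics whose end points stay apart meet a
  compact subset of \<open>\<Omega>\<close>.
\<close>

section \<open>Discs in convex domains\<close>

text \<open>The Kobayashi distance is never computed: chains of affine discs bound it from above and
  half planes bound it from below. Since \<Omega> may be unbounded, the disc estimates hold on
  Euclidean balls only, so a geodesic must first be confined to one. If one limit is a point
  \<open>x\<close> of the closure, the geodesics are cut where they first reach a sphere around
  \<open>x\<close>. If both limits are ends, some compact set \<open>K\<close> tells them apart;
  geodesics are connected, hence must meet \<open>K\<close>, and an accumulation point of such
  meetings takes the place of one end.

  The rescaling is normalised at the point further along the segment towards \<open>p\<close>. There
  the failure of doubling keeps the disc vector away from 0 in the chart, while the point nearer to
  the boundary tends to a boundary point of the limit domain. In the summation the power of \<delta>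
  is split into two halves: one is bounded by the maximum and yields smallness, the other decays
  geometrically and makes the series converge.\<close>

lemma norm_vsmult: "norm (c *s (x :: complex ^ 'n)) = cmod c * norm x"
  by (simp add: norm_vec_def norm_mult L2_set_right_distrib)

lemma of_real_vsmult: "complex_of_real r *s (x :: complex ^ 'n) = r *\<^sub>R x"
  by (simp add: vec_eq_iff) (simp add: scaleR_conv_of_real)

lemma vsmult_scaleR: "c *s (r *\<^sub>R (x :: complex ^ 'n)) = r *\<^sub>R (c *s x)"
  by (simp add: vec_eq_iff)

lemma tendsto_vsmult:
  fixes g :: "'a \<Rightarrow> complex ^ 'n"
  assumes "(f \<longlongrightarrow> c) F" "(g \<longlongrightarrow> v) F"
  shows "((\<lambda>x. f x *s g x) \<longlongrightarrow> c *s v) F"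
  by (intro vec_tendstoI) (use assms in \<open>auto intro!: tendsto_intros\<close>)

lemma convex_open_closure_shrink:
  fixes S :: "'a::euclidean_space set"
  assumes "open S" "convex S" "x \<in> S" "y \<in> closure S" "0 < t" "t \<le> 1"
  shows "y + t *\<^sub>R (x - y) \<in> S"
proof -
  have "y - t *\<^sub>R (y - x) \<in> interior S"
    by (rule mem_interior_closure_convex_shrink) (use assms in \<open>auto simp: interior_open\<close>)
  then show ?thesis
    using assms by (simp add: interior_open algebra_simps)
qed

text \<open>The largest balanced subset of the translate of \<open>S\<close> by \<open>- z\<close>.
  For a convex domain it is comparable, up to a constant factor, with the unit ball of the
  infinitesimal Kobayashi metric at \<open>z\<close>, which is why it can stand in for that
  metric.\<close>

definition disc_dirs :: "(complex ^ 'd) set \<Rightarrow> complex ^ 'd \<Rightarrow> (complex ^ 'd) set" where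
  "disc_dirs S z = {v. \<forall>\<zeta>. cmod \<zeta> \<le> 1 \<longrightarrow> z + \<zeta> *s v \<in> S}"

lemma disc_dirs_mono: "S \<subseteq> T \<Longrightarrow> disc_dirs S z \<subseteq> disc_dirs T z"
  by (auto simp: disc_dirs_def)

lemma disc_dirs_balanced:
  assumes "v \<in> disc_dirs S z" "cmod c \<le> 1"
  shows "c *s v \<in> disc_dirs S z"
  unfolding disc_dirs_def
proof (intro CollectI allI impI)
  fix \<zeta> :: complex assume "cmod \<zeta> \<le> 1"
  then have "cmod (\<zeta> * c) \<le> 1" using assms by (simp add: norm_mult mult_le_one)
  then show "z + \<zeta> *s (c *s v) \<in> S"
    using assms unfolding disc_dirs_def by (simp add: vector_smult_assoc)
qed

lemma disc_dirs_if_cball: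
  assumes "cball z r \<subseteq> S" "norm v \<le> r"
  shows "v \<in> disc_dirs S z"
proof -
  have "z + \<zeta> *s v \<in> cball z r" if "cmod \<zeta> \<le> 1" for \<zeta>
    using that assms(2) mult_mono[of "cmod \<zeta>" 1 "norm v" r]
    by (simp add: dist_norm norm_vsmult)
  then show ?thesis using assms by (auto simp: disc_dirs_def)
qed

text \<open>The point \<open>?b\<close> of \<open>S\<close> lies beyond \<open>p\<close> on the line
  from \<open>z\<close>. The homothety with centre \<open>?b\<close> that takes \<open>z\<close> to
  \<open>p\<close> has ratio \<open>r / (R + r)\<close>, and by convexity it maps the disc at
  \<open>z\<close> into \<open>S\<close>.\<close>

lemma disc_dirs_recentre:
  assumes "convex S" "cball p r \<subseteq> S" "0 < r" "0 < R" "dist z p \<le> R" "v \<in> disc_dirs S z"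
  shows "(r / (R + r)) *\<^sub>R v \<in> disc_dirs S p"
  unfolding disc_dirs_def
proof (intro CollectI allI impI)
  fix \<zeta> :: complex assume "cmod \<zeta> \<le> 1"
  then have 1: "z + \<zeta> *s v \<in> S" using assms(6) by (auto simp: disc_dirs_def)
  let ?b = "p - (r / R) *\<^sub>R (z - p)"
  have "dist p ?b = (r / R) * dist z p" using assms by (simp add: dist_norm)
  also have "\<dots> \<le> (r / R) * R" using assms by (intro mult_left_mono) auto
  finally have 2: "?b \<in> S" using assms by (auto simp: subset_iff)
  have "(r / (R + r)) *\<^sub>R (z + \<zeta> *s v) + (R / (R + r)) *\<^sub>R ?b \<in> S"
    by (rule convexD[OF assms(1) 1 2]) (use assms in \<open>auto simp: divide_simps\<close>)
  moreover have "(r / (R + r)) *\<^sub>R (z + \<zeta> *s v) + (R / (R + r)) *\<^sub>R ?b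
      = p + \<zeta> *s ((r / (R + r)) *\<^sub>R v)"
  proof -
    have "(R / (R + r)) *\<^sub>R ?b = (R / (R + r)) *\<^sub>R p - (r / (R + r)) *\<^sub>R (z - p)"
      using assms by (simp add: scaleR_diff_right)
    moreover have "(R / (R + r)) *\<^sub>R p + (r / (R + r)) *\<^sub>R p = p"
      using assms by (simp flip: scaleR_add_left add_divide_distrib)
    ultimately show ?thesis
      by (simp add: vsmult_scaleR algebra_simps)
  qed
  ultimately show "p + \<zeta> *s ((r / (R + r)) *\<^sub>R v) \<in> S" by simp
qed

lemma properly_convexD:
  assumes "\<Omega> \<in> properly_convex_domains"
  shows "open \<Omega>" "convex \<Omega>" "\<Omega> \<noteq> {}"
  using assms by (auto simp: properly_convex_domains_def)

text \<open>Otherwise the normalised long directions accumulate at some \<open>u\<close>, and the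
  complex line through \<open>p\<close> along \<open>u\<close> lies in the closure. Every point of
  that line is the midpoint of \<open>p\<close> and another of its points, so the line lies in
  \<Omega> itself.\<close>

lemma disc_dirs_closure_bounded:
  assumes \<Omega>: "\<Omega> \<in> properly_convex_domains" and p: "p \<in> \<Omega>"
  shows "bounded (disc_dirs (closure \<Omega>) p)"
proof (rule ccontr)
  assume "\<not> ?thesis"
  then have "\<exists>v. v \<in> disc_dirs (closure \<Omega>) p \<and> norm v > real n" for n
    unfolding bounded_iff by (meson not_le)
  then obtain v where v: "\<And>n. v n \<in> disc_dirs (closure \<Omega>) p" "\<And>n. norm (v n) > real n"
    by metis
  have v0: "norm (v n) > 0" for n using v(2)[of n] by linarith
  define w where "w n = (1 / norm (v n)) *\<^sub>R v n" for n
  have "w n \<in> sphere 0 1" for n using v0[of n] by (simp add: w_def)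
  moreover have "compact (sphere (0 :: complex ^ 'a) 1)" by simp
  ultimately obtain u k where u: "u \<in> sphere 0 1" "strict_mono k" "(w \<circ> k) \<longlonglongrightarrow> u"
    unfolding compact_def by meson
  have line: "p + \<zeta> *s u \<in> closure \<Omega>" for \<zeta> :: complex
  proof (rule Lim_in_closed_set[OF closed_closure])
    show "(\<lambda>n. p + \<zeta> *s (w \<circ> k) n) \<longlonglongrightarrow> p + \<zeta> *s u"
      by (intro tendsto_intros tendsto_vsmult u)
    have "p + \<zeta> *s (w \<circ> k) n \<in> closure \<Omega>" if "n \<ge> nat \<lceil>cmod \<zeta>\<rceil>" for n
    proof -
      have "cmod \<zeta> \<le> real n" using that by linarith
      also have "\<dots> \<le> real (k n)" using seq_suble[OF u(2)] by simp
      also have "\<dots> < norm (v (k n))" by (rule v)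
      finally have "cmod (\<zeta> * complex_of_real (1 / norm (v (k n)))) \<le> 1"
        using v0[of "k n"] by (simp add: norm_mult norm_divide divide_simps)
      then have "p + (\<zeta> * complex_of_real (1 / norm (v (k n)))) *s v (k n) \<in> closure \<Omega>"
        using v(1)[of "k n"] unfolding disc_dirs_def by blast
      then show ?thesis
        by (simp add: w_def vector_smult_assoc flip: of_real_vsmult)
    qed
    then show "\<forall>\<^sub>F n in sequentially. p + \<zeta> *s (w \<circ> k) n \<in> closure \<Omega>"
      unfolding eventually_sequentially by blast
  qed simp
  have "p + \<zeta> *s u \<in> \<Omega>" for \<zeta> :: complex
  proof -
    have 1: "(p + (2 * \<zeta>) *s u) + (1/2) *\<^sub>R (p - (p + (2 * \<zeta>) *s u)) \<in> \<Omega>"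
      by (rule convex_open_closure_shrink) (use properly_convexD[OF \<Omega>] p line in auto)
    have 2: "(p + (2 * \<zeta>) *s u) + (1/2) *\<^sub>R (p - (p + (2 * \<zeta>) *s u)) = p + \<zeta> *s u"
      by (simp add: vec_eq_iff) (simp add: scaleR_conv_of_real)
    show ?thesis using 1 unfolding 2 .
  qed
  moreover have "u \<noteq> 0" using u by auto
  ultimately show False using \<Omega> by (auto simp: properly_convex_domains_def)
qed

text \<open>Discs with any bounded centre are transported to one fixed \<open>p\<close>, where the
  bound for the closure is available.\<close>

lemma disc_dirs_locally_bounded:
  assumes \<Omega>: "\<Omega> \<in> properly_convex_domains"
  obtains M where "M > 0" "\<And>z v. norm z \<le> R \<Longrightarrow> v \<in> disc_dirs \<Omega> z \<Longrightarrow> norm v \<le> M"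
proof -
  obtain p where p: "p \<in> \<Omega>" using properly_convexD[OF \<Omega>] by auto
  obtain r where r: "r > 0" "cball p r \<subseteq> \<Omega>"
    using properly_convexD(1)[OF \<Omega>] p open_contains_cball by blast
  obtain B where B: "B > 0" "\<And>v. v \<in> disc_dirs (closure \<Omega>) p \<Longrightarrow> norm v \<le> B"
    using disc_dirs_closure_bounded[OF \<Omega> p] unfolding bounded_pos by auto
  define R' where "R' = \<bar>R\<bar> + norm p + 1"
  show thesis
  proof (rule that)
    show "B * ((R' + r) / r) > 0"
      unfolding R'_def using B r by (intro mult_pos_pos divide_pos_pos add_nonneg_pos) auto
    fix z v assume z: "norm z \<le> R" and v: "v \<in> disc_dirs \<Omega> z"
    have R': "R' > 0" "dist z p \<le> R'"
      using norm_triangle_ineq4[of z p] z by (auto simp: R'_def dist_norm intro: add_nonneg_pos)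
    have "(r / (R' + r)) *\<^sub>R v \<in> disc_dirs \<Omega> p"
      by (rule disc_dirs_recentre) (use properly_convexD[OF \<Omega>] r R' v in auto)
    then have "norm ((r / (R' + r)) *\<^sub>R v) \<le> B"
      using B(2) disc_dirs_mono[OF closure_subset] by blast
    then show "norm v \<le> B * ((R' + r) / r)"
      using r R' by (simp add: field_simps)
  qed
qed

section \<open>The Kobayashi distance on convex domains\<close>

lemma poincare_dist_commute: "poincare_dist z w = poincare_dist w z"
proof -
  have "cmod (1 - cnj w * z) = cmod (cnj (1 - cnj w * z))" by (rule complex_mod_cnj[symmetric])
  also have "\<dots> = cmod (1 - cnj z * w)" by (simp add: mult.commute)
  finally show ?thesis
    unfolding poincare_dist_def norm_divide by (simp add: norm_minus_commute)
qed

text \<open>Lengths add along a chain, so their exponentials multiply;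
  \<open>(1 + r) / (1 - r)\<close> is the factor by which a positive real part can grow in the half
  plane estimate.\<close>

lemma poincare_dist_pseudo:
  assumes "cmod z < 1" "cmod w < 1"
  defines "r \<equiv> cmod (Moebius_function 0 w z)"
  shows "r < 1" "exp (2 * poincare_dist z w) = (1 + r) / (1 - r)" "0 \<le> poincare_dist z w"
proof -
  show r: "r < 1" unfolding r_def using Moebius_function_norm_lt_1 assms by blast
  have r0: "0 \<le> r" by (simp add: r_def)
  have *: "2 * poincare_dist z w = ln ((1 + r) / (1 - r))"
    by (simp add: r_def poincare_dist_def artanh_def Moebius_function_simple)
  then show "exp (2 * poincare_dist z w) = (1 + r) / (1 - r)"
    using r r0 by (simp add: exp_ln)
  have "0 \<le> ln ((1 + r) / (1 - r))" using r r0 by (intro ln_ge_zero) auto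
  then show "0 \<le> poincare_dist z w" using * by linarith
qed

text \<open>A Moebius map takes 0 to \<alpha> and a Cayley transform takes \<open>f \<alpha>\<close>
  to 0, so that the Schwarz lemma applies to \<open>g\<close>. The right side is linear in
  \<open>Re (f \<alpha>)\<close> so that the estimate can be iterated along a chain.\<close>

lemma halfplane_Schwarz_Pick:
  assumes holf: "f holomorphic_on ball 0 1"
    and pos: "\<And>z. cmod z < 1 \<Longrightarrow> 0 < Re (f z)"
    and \<alpha>: "cmod \<alpha> < 1" and \<beta>: "cmod \<beta> < 1"
  shows "cmod (f \<beta> - f \<alpha>) \<le> (exp (2 * poincare_dist \<alpha> \<beta>) - 1) * Re (f \<alpha>)"
proof -
  define \<psi> where "\<psi> = Moebius_function 0 (- \<alpha>)"
  define \<xi> where "\<xi> = Moebius_function 0 \<alpha> \<beta>"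
  define g where "g = (\<lambda>z. (f (\<psi> z) - f \<alpha>) / (f (\<psi> z) + cnj (f \<alpha>)))"
  have \<psi>1: "cmod (\<psi> z) < 1" if "cmod z < 1" for z
    unfolding \<psi>_def using Moebius_function_norm_lt_1 that \<alpha> by simp
  have \<psi>0: "\<psi> 0 = \<alpha>" by (simp add: \<psi>_def Moebius_function_simple)
  have \<psi>\<xi>: "\<psi> \<xi> = \<beta>" unfolding \<psi>_def \<xi>_def
    by (rule Moebius_function_compose) (use \<alpha> \<beta> in auto)
  have \<xi>: "cmod \<xi> < 1" unfolding \<xi>_def using Moebius_function_norm_lt_1 \<alpha> \<beta> by blast
  have nz: "f w + cnj (f \<alpha>) \<noteq> 0" if "cmod w < 1" for w
  proof
    assume "f w + cnj (f \<alpha>) = 0"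
    then have "Re (f w + cnj (f \<alpha>)) = Re 0" by (rule arg_cong)
    then have "Re (f w) + Re (f \<alpha>) = 0" by simp
    then show False using pos[OF that] pos[OF \<alpha>] by linarith
  qed
  have hol\<psi>: "\<psi> holomorphic_on ball 0 1"
    unfolding \<psi>_def using \<alpha> by (intro Moebius_function_holomorphic) simp
  have "(f \<circ> \<psi>) holomorphic_on ball 0 1"
    by (intro holomorphic_on_compose_gen[OF hol\<psi> holf]) (auto simp: \<psi>1)
  then have "g holomorphic_on ball 0 1"
    unfolding g_def comp_def using nz \<psi>1 by (intro holomorphic_intros) auto
  moreover have "g 0 = 0" by (simp add: g_def \<psi>0)
  moreover have "cmod (g z) < 1" if z: "cmod z < 1" for z
  proof -
    let ?w = "f (\<psi> z)" and ?a = "f \<alpha>"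
    have "0 < Re ?w" "0 < Re ?a" using pos \<psi>1 z \<alpha> by auto
    then have "0 < Re ?w * Re ?a" by simp
    then have "(Re ?w - Re ?a)\<^sup>2 + (Im ?w - Im ?a)\<^sup>2 < (Re ?w + Re ?a)\<^sup>2 + (Im ?w - Im ?a)\<^sup>2"
      by (simp add: power2_eq_square algebra_simps)
    then have "(cmod (?w - ?a))\<^sup>2 < (cmod (?w + cnj ?a))\<^sup>2"
      by (simp add: cmod_power2)
    then have "cmod (?w - ?a) < cmod (?w + cnj ?a)"
      by (rule power2_less_imp_less) simp
    then show ?thesis unfolding g_def norm_divide
      using nz[OF \<psi>1[OF z]] by simp
  qed
  ultimately have "cmod (g \<xi>) \<le> cmod \<xi>" using \<xi> by (intro Schwarz_Lemma)
  then have *: "cmod (f \<beta> - f \<alpha>) \<le> cmod \<xi> * cmod (f \<beta> + cnj (f \<alpha>))"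
    using nz[OF \<beta>] by (simp add: g_def \<psi>\<xi> norm_divide divide_simps)
  \<comment> \<open>This brings \<open>f \<beta> - f \<alpha>\<close> to the right side with a
    coefficient \<open>cmod \<xi> < 1\<close>, where it can be absorbed into the left side.\<close>
  have "f \<beta> + cnj (f \<alpha>) = (f \<beta> - f \<alpha>) + complex_of_real (2 * Re (f \<alpha>))"
    by (simp add: complex_eq_iff)
  then have "cmod (f \<beta> + cnj (f \<alpha>)) \<le> cmod (f \<beta> - f \<alpha>) + 2 * Re (f \<alpha>)"
    using norm_triangle_ineq[of "f \<beta> - f \<alpha>" "complex_of_real (2 * Re (f \<alpha>))"] pos[OF \<alpha>]
    by (simp only: norm_of_real abs_of_pos mult_pos_pos zero_less_numeral)
  then have "cmod \<xi> * cmod (f \<beta> + cnj (f \<alpha>)) \<le> cmod \<xi> * (cmod (f \<beta> - f \<alpha>) + 2 * Re (f \<alpha>))"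
    by (intro mult_left_mono) auto
  with * have "cmod (f \<beta> - f \<alpha>) * (1 - cmod \<xi>) \<le> 2 * cmod \<xi> * Re (f \<alpha>)"
    by (simp add: algebra_simps)
  then have "cmod (f \<beta> - f \<alpha>) \<le> (2 * cmod \<xi> / (1 - cmod \<xi>)) * Re (f \<alpha>)"
    using \<xi> by (simp add: field_simps)
  also have "2 * cmod \<xi> / (1 - cmod \<xi>) = exp (2 * poincare_dist \<alpha> \<beta>) - 1"
    unfolding poincare_dist_commute[of \<alpha> \<beta>] poincare_dist_pseudo(2)[OF \<beta> \<alpha>] \<xi>_def[symmetric]
    using \<xi> by (simp add: field_simps)
  finally show ?thesis .
qed

section \<open>Chains of discs and upper bounds for the distance\<close>

inductive disc_chain :: "(complex ^ 'd) set \<Rightarrow> complex ^ 'd \<Rightarrow> complex ^ 'd \<Rightarrow> real \<Rightarrow> bool"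
  for \<Omega> where
  disc_chain_refl: "disc_chain \<Omega> x x 0"
| disc_chain_step: "disc_chain \<Omega> x y s \<Longrightarrow> holomorphic_disc f \<Omega> \<Longrightarrow> \<alpha> \<in> ball 0 1 \<Longrightarrow> \<beta> \<in> ball 0 1 \<Longrightarrow>
    f \<alpha> = y \<Longrightarrow> f \<beta> = z \<Longrightarrow> disc_chain \<Omega> x z (s + poincare_dist \<alpha> \<beta>)"

lemma disc_chain_nonneg: "disc_chain \<Omega> x y s \<Longrightarrow> 0 \<le> s"
  by (induction rule: disc_chain.induct) (auto simp: poincare_dist_pseudo(3))

lemma disc_chain_trans:
  assumes "disc_chain \<Omega> y z t" "disc_chain \<Omega> x y s"
  shows "disc_chain \<Omega> x z (s + t)"
  using assms
proof (induction rule: disc_chain.induct)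
  case (disc_chain_step w y' s' f \<alpha> \<beta> z)
  then have "disc_chain \<Omega> x z ((s + s') + poincare_dist \<alpha> \<beta>)"
    by (intro disc_chain.disc_chain_step[where f = f]) auto
  then show ?case by (simp add: add.assoc)
qed simp

lemma disc_chain_sym:
  assumes "disc_chain \<Omega> x y s"
  shows "disc_chain \<Omega> y x s"
  using assms
proof (induction rule: disc_chain.induct)
  case (disc_chain_step x y s f \<alpha> \<beta> z)
  have "disc_chain \<Omega> z y (0 + poincare_dist \<beta> \<alpha>)"
    by (intro disc_chain.disc_chain_step[where f = f] disc_chain_refl) (use disc_chain_step in \<open>auto intro: disc_chain_refl\<close>)
  then show ?case
    using disc_chain_trans[OF disc_chain_step.IH] by (metis add.commute add_0 poincare_dist_commute)
qed (rule disc_chain_refl)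

text \<open>Trades the indexed families of the definition for an inductive predicate, whose chains
  can be concatenated, reversed and used for induction.\<close>

lemma kobayashi_dist_disc_chain: "kobayashi_dist \<Omega> x y = Inf {s. disc_chain \<Omega> x y s}"
proof -
  let ?P = "\<lambda>s x y m p f \<alpha> \<beta>. s = (\<Sum>i<m. poincare_dist (\<alpha> i) (\<beta> i)) \<and> p 0 = x \<and> p m = y \<and>
            (\<forall>i<m. holomorphic_disc (f i) \<Omega> \<and> \<alpha> i \<in> ball 0 1 \<and> \<beta> i \<in> ball 0 1 \<and>
                   f i (\<alpha> i) = p i \<and> f i (\<beta> i) = p (Suc i))"
  have 1: "disc_chain \<Omega> x y s" if P: "?P s x y m p f \<alpha> \<beta>" for s m p f \<alpha> \<beta>
  proof -
    have "disc_chain \<Omega> x (p k) (\<Sum>i<k. poincare_dist (\<alpha> i) (\<beta> i))" if "k \<le> m" for k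
      using that
    proof (induction k)
      case 0 then show ?case using P by (auto intro: disc_chain_refl)
    next
      case (Suc k)
      then show ?case using P
        by (auto intro!: disc_chain_step[where f = "f k"])
    qed
    from this[of m] show ?thesis using P by simp
  qed
  have 2: "\<exists>m p f \<alpha> \<beta>. ?P s x y m p f \<alpha> \<beta>" if "disc_chain \<Omega> x y s" for s
    using that
  proof (induction rule: disc_chain.induct)
    case (disc_chain_refl x)
    show ?case by (intro exI[of _ 0] exI[of _ "\<lambda>_. x"]) auto
  next
    case (disc_chain_step x y s g a b z)
    then obtain m p f \<alpha> \<beta> where P: "?P s x y m p f \<alpha> \<beta>" by blast
    have "?P (s + poincare_dist a b) x z (Suc m) (p(Suc m := z)) (f(m := g)) (\<alpha>(m := a)) (\<beta>(m := b))"
      using P disc_chain_step by (auto simp: less_Suc_eq)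
    then show ?case by blast
  qed
  have "(\<exists>m p f \<alpha> \<beta>. ?P s x y m p f \<alpha> \<beta>) \<longleftrightarrow> disc_chain \<Omega> x y s" for s
    by (rule iffI, elim exE, rule 1, assumption, rule 2)
  then show ?thesis
    unfolding kobayashi_dist_def by (rule arg_cong[OF Collect_cong])
qed

lemma kobayashi_dist_le: "disc_chain \<Omega> x y s \<Longrightarrow> kobayashi_dist \<Omega> x y \<le> s"
  unfolding kobayashi_dist_disc_chain
  by (rule cInf_lower) (auto intro!: bdd_belowI disc_chain_nonneg)

text \<open>A cost of 1/2 per disc suffices later: two chains of \<open>j + 1\<close> discs have
  total length at most \<open>j + 1\<close>, which is less than the time \<open>j + 2\<close> with
  which the decay estimate compares them.\<close>

lemma artanh_third: "artanh (1/3 :: real) \<le> 1/2"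
proof -
  have "artanh (1/3 :: real) = ln 2 / 2" by (simp add: artanh_def)
  moreover have "ln 2 \<le> (1 :: real)" using ln_le_minus_one[of 2] by simp
  ultimately show ?thesis by simp
qed

lemma disc_chain_in_ball:
  assumes "disc_chain \<Omega> w x s" "ball x \<rho> \<subseteq> \<Omega>" "3 * dist x y \<le> \<rho>" "0 < \<rho>"
  shows "disc_chain \<Omega> w y (s + artanh (1/3))"
proof -
  \<comment> \<open>The disc is three times as large as the step from \<open>x\<close> to
    \<open>y\<close>, so \<open>y\<close> sits at parameter 1/3.\<close>
  define f where "f = (\<lambda>\<zeta>. x + \<zeta> *s (3 *\<^sub>R (y - x)))"
  have "f \<zeta> \<in> ball x \<rho>" if "cmod \<zeta> < 1" for \<zeta>
  proof -
    have "dist x (f \<zeta>) = cmod \<zeta> * (3 * dist x y)"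
      by (simp add: f_def dist_norm norm_vsmult norm_minus_commute)
    also have "\<dots> \<le> cmod \<zeta> * \<rho>" using assms by (intro mult_left_mono) auto
    also have "\<dots> < 1 * \<rho>" using that assms by (intro mult_strict_right_mono) auto
    finally show ?thesis by simp
  qed
  then have hol: "holomorphic_disc f \<Omega>" using assms(2)
    by (auto simp: holomorphic_disc_def f_def intro!: holomorphic_intros)
  have "f (1/3) = y"
    by (simp add: f_def vec_eq_iff) (simp add: scaleR_conv_of_real field_simps)
  then have "disc_chain \<Omega> w y (s + poincare_dist 0 (1/3))"
    by (intro disc_chain_step[OF assms(1) hol]) (auto simp: f_def)
  then show ?thesis by (simp add: poincare_dist_def norm_divide)
qed

text \<open>
  Walking from \<open>p\<close> towards \<open>z\<close> along the segment, the inscribed balls shrink geometrically, so that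
  the number of discs needed is logarithmic in the distance \<open>\<delta>\<close> of \<open>z\<close> to the boundary.
\<close>

lemma disc_chain_to_point:
  assumes \<Omega>: "open \<Omega>" "convex \<Omega>"
    and r: "0 < r" "ball p r \<subseteq> \<Omega>"
    and z: "dist p z \<le> R" "r \<le> R"
    and \<delta>: "0 < \<delta>" "ball z \<delta> \<subseteq> \<Omega>"
    and j: "3 * ((1 - r / (3 * R)) ^ j * R) \<le> \<delta>"
  shows "\<exists>s \<le> (real j + 1) / 2. disc_chain \<Omega> p z s"
proof -
  \<comment> \<open>With this ratio, consecutive points \<open>P (l ^ k)\<close> and
    \<open>P (l ^ Suc k)\<close> are at most one third of the radius \<open>l ^ k * r\<close> apart,
    as \<open>disc_chain_in_ball\<close> requires.\<close>
  define l where "l = 1 - r / (3 * R)"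
  have l: "0 < l" "l \<le> 1" using r z by (auto simp: l_def field_simps)
  define P where "P s = z + s *\<^sub>R (p - z)" for s :: real
  have zin: "z \<in> \<Omega>" using \<delta> by auto
  \<comment> \<open>The homothety with centre \<open>z\<close> and ratio \<open>s\<close> carries
    \<open>ball p r\<close> onto this ball.\<close>
  have ball: "ball (P s) (s * r) \<subseteq> \<Omega>" if "0 < s" "s \<le> 1" for s
  proof
    fix x assume x: "x \<in> ball (P s) (s * r)"
    define q where "q = p + (1 / s) *\<^sub>R (x - P s)"
    have "dist p q = norm (x - P s) / s" using that by (simp add: q_def dist_norm)
    moreover have "norm (x - P s) < s * r" using x by (simp add: dist_norm norm_minus_commute)
    ultimately have "dist p q < r" using that by (simp add: divide_less_eq mult.commute)
    then have "q \<in> \<Omega>" using r by auto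
    then have "z + s *\<^sub>R (q - z) \<in> \<Omega>"
      by (intro convex_open_closure_shrink) (use \<Omega> zin that closure_subset in auto)
    also have "z + s *\<^sub>R (q - z) = x"
      using that by (simp add: q_def P_def algebra_simps)
    finally show "x \<in> \<Omega>" .
  qed
  have chain: "disc_chain \<Omega> p (P (l ^ k)) (real k * artanh (1/3))" for k
  proof (induction k)
    case 0 show ?case by (simp add: P_def disc_chain_refl)
  next
    case (Suc k)
    have lk: "0 < l ^ k" "l ^ k \<le> 1" using l by (auto simp: power_le_one)
    have "P (l ^ k) - P (l ^ Suc k) = ((1 - l) * l ^ k) *\<^sub>R (p - z)"
      by (simp add: P_def algebra_simps)
    then have "dist (P (l ^ k)) (P (l ^ Suc k)) = ((1 - l) * l ^ k) * dist p z"
      using l lk by (simp add: dist_norm)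
    also have "\<dots> \<le> ((1 - l) * l ^ k) * R" using l lk z by (intro mult_left_mono) auto
    also have "\<dots> = l ^ k * r / 3" using r z by (simp add: l_def field_simps)
    finally have "3 * dist (P (l ^ k)) (P (l ^ Suc k)) \<le> l ^ k * r" by simp
    from disc_chain_in_ball[OF Suc.IH ball[OF lk] this] show ?case
      using lk r by (simp add: algebra_simps)
  qed
  \<comment> \<open>The last disc lies in the ball around \<open>z\<close>; it accounts for the
    extra 1 in \<open>real j + 1\<close>.\<close>
  have "dist z (P (l ^ j)) = l ^ j * dist p z"
    using l by (simp add: P_def dist_norm)
  also have "\<dots> \<le> l ^ j * R" using l z by (intro mult_left_mono) auto
  finally have "3 * dist z (P (l ^ j)) \<le> \<delta>" using j unfolding l_def by linarith
  from disc_chain_in_ball[OF disc_chain_refl \<delta>(2) this \<delta>(1)]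
  have "disc_chain \<Omega> (P (l ^ j)) z (0 + artanh (1/3))" by (rule disc_chain_sym)
  from disc_chain_trans[OF this chain]
  have "disc_chain \<Omega> p z (real j * artanh (1/3) + artanh (1/3))" by simp
  moreover have "real j * artanh (1/3) + artanh (1/3) \<le> (real j + 1) * (1/2)"
    using mult_left_mono[OF artanh_third, of "real j + 1"] by (simp add: algebra_simps)
  ultimately show ?thesis by (intro exI conjI) auto
qed

text \<open>Ensures that the infimum in the Kobayashi distance ranges over a nonempty set, so that
  lower bounds for all chains are lower bounds for the distance.\<close>

lemma disc_chain_exists:
  assumes \<Omega>: "open \<Omega>" "convex \<Omega>" and "p \<in> \<Omega>" "z \<in> \<Omega>"
  shows "\<exists>s. disc_chain \<Omega> p z s"
proof -
  obtain r where r: "r > 0" "ball p r \<subseteq> \<Omega>" using assms open_contains_ball by blast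
  obtain \<delta> where \<delta>: "\<delta> > 0" "ball z \<delta> \<subseteq> \<Omega>" using assms open_contains_ball by blast
  define R where "R = max r (dist p z)"
  have R: "R > 0" "r \<le> R" "dist p z \<le> R" using r by (auto simp: R_def)
  have "\<bar>1 - r / (3 * R)\<bar> < 1" using r R by (auto simp: field_simps abs_less_iff)
  then have "(\<lambda>j. 3 * ((1 - r / (3 * R)) ^ j * R)) \<longlonglongrightarrow> 3 * (0 * R)"
    by (intro tendsto_intros LIMSEQ_power_zero) simp
  then have "(\<lambda>j. 3 * ((1 - r / (3 * R)) ^ j * R)) \<longlonglongrightarrow> 0" by simp
  from order_tendstoD(2)[OF this \<delta>(1)] obtain j where "3 * ((1 - r / (3 * R)) ^ j * R) < \<delta>"
    by (meson eventually_sequentially order_refl)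
  with disc_chain_to_point[OF \<Omega> r R(3,2) \<delta>, of j] show ?thesis by auto
qed

section \<open>Lower bounds from separating half planes\<close>

lemma open_convex_separate_point:
  fixes S :: "'a::euclidean_space set"
  assumes "open S" "convex S" "S \<noteq> {}" "y \<notin> S"
  obtains a where "\<And>x. x \<in> S \<Longrightarrow> a \<bullet> (x - y) > 0"
proof -
  obtain a b where a: "a \<noteq> 0" "a \<bullet> y \<le> b" "\<And>x. x \<in> S \<Longrightarrow> a \<bullet> x \<ge> b"
    using separating_hyperplane_set_point_inaff[OF assms(2-4)] by metis
  show thesis
  proof
    fix x assume "x \<in> S"
    then obtain e where e: "e > 0" "cball x e \<subseteq> S" using assms(1) open_contains_cball by blast
    let ?x = "x - (e / norm a) *\<^sub>R a"
    have "?x \<in> S" using e a(1) by (intro subsetD[OF e(2)]) (simp add: dist_norm)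
    then have "b \<le> a \<bullet> ?x" using a by blast
    also have "\<dots> < a \<bullet> x" using a(1) e by (simp add: inner_diff_right)
    finally show "a \<bullet> (x - y) > 0" using a(2) by (simp add: inner_diff_right)
  qed
qed

text \<open>\<open>h\<close> is complex affine and its real part is the real functional given by
  \<open>a\<close>, so every disc is mapped into the right half plane. Each disc multiplies the real
  part by at most the exponential of twice its length, and the increments telescope to
  \<open>exp (2 * s) - 1\<close>.\<close>

lemma disc_chain_functional_bound:
  fixes a y :: "complex ^ 'd"
  defines "h \<equiv> (\<lambda>x. \<Sum>i\<in>UNIV. cnj (a $ i) * ((x - y) $ i))"
  assumes pos: "\<And>x. x \<in> \<Omega> \<Longrightarrow> Re (h x) > 0"
    and "disc_chain \<Omega> z w s" "z \<in> \<Omega>"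
  shows "cmod (h w - h z) \<le> (exp (2 * s) - 1) * Re (h z)"
  using assms(3,4)
proof (induction rule: disc_chain.induct)
  case (disc_chain_step x y' s f \<alpha> \<beta> z)
  have hol: "(\<lambda>\<zeta>. h (f \<zeta>)) holomorphic_on ball 0 1"
    unfolding h_def using disc_chain_step(2)
    by (auto simp: holomorphic_disc_def intro!: holomorphic_intros)
  have ab: "cmod \<alpha> < 1" "cmod \<beta> < 1" using disc_chain_step by auto
  have "cmod (h (f \<beta>) - h (f \<alpha>)) \<le> (exp (2 * poincare_dist \<alpha> \<beta>) - 1) * Re (h (f \<alpha>))"
    by (rule halfplane_Schwarz_Pick[OF hol])
      (use ab disc_chain_step(2) pos in \<open>auto simp: holomorphic_disc_def image_subset_iff\<close>)
  then have 1: "cmod (h z - h y') \<le> (exp (2 * poincare_dist \<alpha> \<beta>) - 1) * Re (h y')"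
    using disc_chain_step by simp
  have IH: "cmod (h y' - h x) \<le> (exp (2 * s) - 1) * Re (h x)"
    using disc_chain_step by blast
  have "Re (h y') \<le> Re (h x) + cmod (h y' - h x)"
    using complex_Re_le_cmod[of "h y' - h x"] by simp
  also have "\<dots> \<le> exp (2 * s) * Re (h x)" using IH by (simp add: algebra_simps)
  finally have "(exp (2 * poincare_dist \<alpha> \<beta>) - 1) * Re (h y')
      \<le> (exp (2 * poincare_dist \<alpha> \<beta>) - 1) * (exp (2 * s) * Re (h x))"
    using poincare_dist_pseudo(3)[OF ab] by (intro mult_left_mono) auto
  with 1 IH have "cmod (h z - h y') + cmod (h y' - h x)
      \<le> (exp (2 * poincare_dist \<alpha> \<beta>) - 1) * (exp (2 * s) * Re (h x)) + (exp (2 * s) - 1) * Re (h x)"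
    by linarith
  also have "\<dots> = (exp (2 * (s + poincare_dist \<alpha> \<beta>)) - 1) * Re (h x)"
    by (simp add: distrib_left exp_add algebra_simps)
  finally show ?case using norm_triangle_ineq[of "h z - h y'" "h y' - h x"] by simp
qed simp

text \<open>If the disc leaves \<Omega> at \<open>y\<close>, a half plane separating
  \<open>y\<close> from \<Omega> gives a complex affine \<open>h\<close> vanishing at
  \<open>y\<close>. As \<open>y - z\<close> is a multiple of \<open>w - z\<close>, the size of
  \<open>h z\<close> is at most \<open>c\<close> times the variation of \<open>h\<close> from
  \<open>z\<close> to \<open>w\<close>, and a short chain cannot produce so much variation.\<close>

lemma disc_dirs_kobayashi:
  fixes \<Omega> :: "(complex ^ 'd) set"
  assumes \<Omega>: "open \<Omega>" "convex \<Omega>" and z: "z \<in> \<Omega>" and w: "w \<in> \<Omega>"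
    and c: "c > 0" "c * (exp (2 * kobayashi_dist \<Omega> z w) - 1) < 1"
  shows "c *\<^sub>R (w - z) \<in> disc_dirs \<Omega> z"
proof (rule ccontr)
  assume "\<not> ?thesis"
  then obtain \<zeta> where \<zeta>: "cmod \<zeta> \<le> 1" "z + \<zeta> *s (c *\<^sub>R (w - z)) \<notin> \<Omega>"
    by (auto simp: disc_dirs_def)
  define y where "y = z + \<zeta> *s (c *\<^sub>R (w - z))"
  obtain a where a: "\<And>x. x \<in> \<Omega> \<Longrightarrow> a \<bullet> (x - y) > 0"
    using open_convex_separate_point[OF \<Omega>, of y] z \<zeta> unfolding y_def by blast
  define h where "h = (\<lambda>x. \<Sum>i\<in>UNIV. cnj (a $ i) * ((x - y) $ i))"
  have Reh: "Re (h x) = a \<bullet> (x - y)" for x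
    by (simp add: h_def inner_vec_def inner_complex_def Re_sum)
  have pos: "Re (h x) > 0" if "x \<in> \<Omega>" for x using a that Reh by simp
  have "h z = - \<zeta> * c * (h w - h z)"
    unfolding h_def
    by (simp add: y_def sum_distrib_left flip: sum_subtractf sum_negf)
      (simp add: algebra_simps scaleR_conv_of_real)
  then have "cmod (h z) = cmod \<zeta> * (c * cmod (h w - h z))"
    using c(1) by (metis norm_mult norm_minus_cancel norm_of_real abs_of_pos mult.assoc)
  also have "\<dots> \<le> 1 * (c * cmod (h w - h z))"
    using \<zeta> c by (intro mult_right_mono) auto
  finally have hz: "cmod (h z) \<le> c * cmod (h w - h z)" by simp
  \<comment> \<open>The bound does not depend on the chain, so it passes to the infimum and
    contradicts the choice of \<open>c\<close>.\<close>
  have bound: "ln (1 + 1 / c) / 2 \<le> s" if s: "disc_chain \<Omega> z w s" for s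
  proof -
    have "Re (h z) \<le> c * cmod (h w - h z)" using hz complex_Re_le_cmod order_trans by blast
    also have "\<dots> \<le> c * ((exp (2 * s) - 1) * Re (h z))"
      using disc_chain_functional_bound[of \<Omega> a y z w s] pos s z c
      unfolding h_def by (intro mult_left_mono) auto
    finally have "1 * Re (h z) \<le> (c * (exp (2 * s) - 1)) * Re (h z)" by (simp add: mult.assoc)
    then have "1 \<le> c * (exp (2 * s) - 1)" using pos[OF z] by (simp only: mult_le_cancel_right_pos)
    then have "1 + 1 / c \<le> exp (2 * s)" using c by (simp add: field_simps)
    then have "ln (1 + 1 / c) \<le> ln (exp (2 * s))" using c by (intro ln_mono) (auto intro: add_pos_pos)
    then show ?thesis by simp
  qed
  have "ln (1 + 1 / c) / 2 \<le> kobayashi_dist \<Omega> z w"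
    unfolding kobayashi_dist_disc_chain
    by (rule cInf_greatest) (use disc_chain_exists[OF \<Omega> z w] bound in auto)
  then have "exp (ln (1 + 1 / c)) \<le> exp (2 * kobayashi_dist \<Omega> z w)" by simp
  then have "1 + 1 / c \<le> exp (2 * kobayashi_dist \<Omega> z w)" using c by (simp add: add_pos_pos)
  then show False using c by (simp add: field_simps)
qed

section \<open>Normalisation by affine maps\<close>

lemma convex_disc_dirs: "convex S \<Longrightarrow> convex (disc_dirs S z)"
proof (rule convexI)
  fix x y and u v :: real
  assume S: "convex S" and x: "x \<in> disc_dirs S z" and y: "y \<in> disc_dirs S z"
    and uv: "0 \<le> u" "0 \<le> v" "u + v = 1"
  show "u *\<^sub>R x + v *\<^sub>R y \<in> disc_dirs S z"
    unfolding disc_dirs_def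
  proof (intro CollectI allI impI)
    fix \<zeta> :: complex assume "cmod \<zeta> \<le> 1"
    then have "u *\<^sub>R (z + \<zeta> *s x) + v *\<^sub>R (z + \<zeta> *s y) \<in> S"
      using x y by (intro convexD[OF S _ _ uv]) (auto simp: disc_dirs_def)
    also have "u *\<^sub>R (z + \<zeta> *s x) + v *\<^sub>R (z + \<zeta> *s y)
        = (u + v) *\<^sub>R z + \<zeta> *s (u *\<^sub>R x + v *\<^sub>R y)"
      by (simp add: vector_add_ldistrib vsmult_scaleR algebra_simps)
    finally show "z + \<zeta> *s (u *\<^sub>R x + v *\<^sub>R y) \<in> S" using uv by simp
  qed
qed

lemma closed_disc_dirs:
  assumes "closed S" shows "closed (disc_dirs S z)"
proof -
  have "closed {v. z + \<zeta> *s v \<in> S}" for \<zeta> :: complex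
  proof -
    have "continuous_on UNIV (\<lambda>v. z + \<zeta> *s v)"
      unfolding continuous_on_def by (intro ballI tendsto_intros tendsto_vsmult)
    from continuous_closed_vimage[OF assms, of "\<lambda>v. z + \<zeta> *s v"] this show ?thesis
      by (simp add: vimage_def continuous_on_eq_continuous_at)
  qed
  then have "closed (\<Inter>\<zeta>\<in>{\<zeta>. cmod \<zeta> \<le> 1}. {v. z + \<zeta> *s v \<in> S})" by auto
  also have "(\<Inter>\<zeta>\<in>{\<zeta>. cmod \<zeta> \<le> 1}. {v. z + \<zeta> *s v \<in> S}) = disc_dirs S z"
    by (auto simp: disc_dirs_def)
  finally show ?thesis .
qed

lemma norm_le_card:
  fixes u :: "complex ^ 'd"
  assumes "\<And>i. cmod (u $ i) \<le> c"
  shows "norm u \<le> real CARD('d) * c"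
proof -
  have "norm u \<le> (\<Sum>i\<in>UNIV. cmod (u $ i))"
    unfolding norm_vec_def by (rule L2_set_le_sum) simp
  also have "\<dots> \<le> real CARD('d) * c"
    using sum_bounded_above[of UNIV "\<lambda>i. cmod (u $ i)" c] assms by simp
  finally show ?thesis .
qed

text \<open>
  An Auerbach basis: the columns of \<open>P\<close> maximise the determinant among all bases consisting of
  directions of discs centred at \<open>z\<close>.
\<close>

lemma disc_dirs_Auerbach:
  fixes \<Omega> :: "(complex ^ 'd) set"
  assumes \<Omega>: "\<Omega> \<in> properly_convex_domains" and z: "z \<in> \<Omega>"
  obtains P :: "complex ^ 'd ^ 'd" where "invertible P"
    "\<And>w. norm w \<le> 1 / (2 * real CARD('d)) \<Longrightarrow> z + P *v w \<in> \<Omega>"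
    "\<And>u i. P *v u \<in> disc_dirs \<Omega> z \<Longrightarrow> cmod (u $ i) \<le> 1"
proof -
  \<comment> \<open>Passing to the closure makes \<open>B\<close> compact, so that a determinant of
    maximal modulus exists. The factor 2 in the radius \<open>1 / (2 * real CARD('d))\<close> leads
    back from the closure to \<Omega>.\<close>
  define B where "B = disc_dirs (closure \<Omega>) z"
  have cB: "compact B" unfolding B_def
    using disc_dirs_closure_bounded[OF \<Omega> z] closed_disc_dirs compact_eq_bounded_closed closed_closure
    by blast
  have vB: "convex B" unfolding B_def
    using \<Omega> by (intro convex_disc_dirs convex_closure properly_convexD)
  define S where "S = {P :: complex ^ 'd ^ 'd. \<forall>j. column j P \<in> B}"
  obtain M where M: "\<And>v. v \<in> B \<Longrightarrow> norm v \<le> M"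
    using compact_imp_bounded[OF cB] unfolding bounded_iff by auto
  have "bounded S"
  proof -
    have "norm P \<le> (\<Sum>i\<in>(UNIV::'d set). \<Sum>j\<in>(UNIV::'d set). M)" if "P \<in> S" for P
    proof -
      have entry: "cmod (P $ i $ j) \<le> M" for i j
        using M[of "column j P"] that Finite_Cartesian_Product.norm_nth_le[of "column j P" i]
        by (auto simp: S_def column_def)
      have "norm P \<le> (\<Sum>i\<in>UNIV. norm (P $ i))"
        unfolding norm_vec_def[of P] by (rule L2_set_le_sum) simp
      also have "\<dots> \<le> (\<Sum>i\<in>UNIV. \<Sum>j\<in>UNIV. cmod (P $ i $ j))"
        by (intro sum_mono) (unfold norm_vec_def[of "P $ i" for i], rule L2_set_le_sum, simp)
      also have "\<dots> \<le> (\<Sum>i\<in>(UNIV::'d set). \<Sum>j\<in>(UNIV::'d set). M)"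
        by (intro sum_mono entry)
      finally show ?thesis .
    qed
    then show ?thesis unfolding bounded_iff by blast
  qed
  moreover have "closed S"
  proof -
    have "closed {P :: complex ^ 'd ^ 'd. column j P \<in> B}" for j
    proof -
      have "continuous_on UNIV (\<lambda>P :: complex ^ 'd ^ 'd. column j P)"
        unfolding column_def by (intro continuous_intros)
      with continuous_closed_vimage[OF compact_imp_closed[OF cB], of "\<lambda>P. column j P"] show ?thesis
        by (simp add: vimage_def continuous_on_eq_continuous_at)
    qed
    then have "closed (\<Inter>j. {P :: complex ^ 'd ^ 'd. column j P \<in> B})" by auto
    then show ?thesis by (simp add: S_def Collect_all_eq)
  qed
  ultimately have cS: "compact S" using compact_eq_bounded_closed by blast
  obtain r where r: "r > 0" "cball z r \<subseteq> \<Omega>"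
    using properly_convexD(1)[OF \<Omega>] z open_contains_cball by blast
  \<comment> \<open>The basis taken from an inscribed ball shows that the maximal determinant is not
    0.\<close>
  define Q :: "complex ^ 'd ^ 'd" where "Q = (\<chi> i j. if i = j then complex_of_real r else 0)"
  have colQ: "column j Q = axis j (complex_of_real r)" for j
    by (simp add: Q_def column_def axis_def vec_eq_iff)
  have "column j Q \<in> B" for j
  proof -
    have "norm (axis j (complex_of_real r) :: complex ^ 'd) = r"
      using r by (simp add: norm_eq_sqrt_inner inner_axis_axis inner_complex_def)
    then show ?thesis
      unfolding B_def colQ using r closure_subset[of \<Omega>]
      by (intro disc_dirs_if_cball[of _ r]) auto
  qed
  then have QS: "Q \<in> S" by (simp add: S_def)
  have "det Q = (\<Prod>i\<in>UNIV. Q $ i $ i)" by (rule det_diagonal) (simp add: Q_def)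
  then have detQ: "det Q \<noteq> 0" using r by (simp add: Q_def)
  have "continuous_on S (\<lambda>P :: complex ^ 'd ^ 'd. cmod (det P))"
    unfolding det_def by (intro continuous_intros)
  then obtain P where P: "P \<in> S" "\<And>P'. P' \<in> S \<Longrightarrow> cmod (det P') \<le> cmod (det P)"
    using continuous_attains_sup[OF cS] QS by blast
  have detP: "det P \<noteq> 0" using P(2)[OF QS] detQ by auto
  show thesis
  proof
    show "invertible P" using detP invertible_det_nz by blast
    fix u i assume "P *v u \<in> disc_dirs \<Omega> z"
    then have "P *v u \<in> B" unfolding B_def using disc_dirs_mono[OF closure_subset] by blast
    \<comment> \<open>Exchanging column \<open>i\<close> of \<open>P\<close> for
      \<open>P *v u\<close> multiplies the determinant by \<open>u $ i\<close>, by Cramer's rule, so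
      maximality bounds that coordinate.\<close>
    moreover have "column j (\<chi> k j. if j = i then (P *v u) $ k else P $ k $ j)
        = (if j = i then P *v u else column j P)" for j
      by (simp add: column_def vec_eq_iff)
    ultimately have "(\<chi> k j. if j = i then (P *v u) $ k else P $ k $ j) \<in> S"
      using P(1) by (auto simp: S_def)
    from P(2)[OF this] have "cmod (u $ i) * cmod (det P) \<le> 1 * cmod (det P)"
      unfolding cramer_lemma by (simp add: norm_mult)
    then show "cmod (u $ i) \<le> 1" using detP by simp
  next
    fix w :: "complex ^ 'd" assume w: "norm w \<le> 1 / (2 * real CARD('d))"
    let ?d = "real CARD('d)"
    \<comment> \<open>\<open>2 *\<^sub>R (P *v w)\<close> is the average of these vectors over
      \<open>i\<close>, so balancedness and convexity of \<open>B\<close> suffice.\<close>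
    have "complex_of_real (2 * ?d) * w $ i *s column i P \<in> B" for i
    proof -
      have "cmod (w $ i) \<le> 1 / (2 * ?d)" using w Finite_Cartesian_Product.norm_nth_le[of w i] by linarith
      then have "cmod (complex_of_real (2 * ?d) * w $ i) \<le> 1"
        by (simp add: norm_mult field_simps)
      then show ?thesis using P(1) unfolding B_def S_def by (intro disc_dirs_balanced) auto
    qed
    then have "(\<Sum>i\<in>UNIV. (1 / ?d) *\<^sub>R (complex_of_real (2 * ?d) * w $ i *s column i P)) \<in> B"
      by (intro convex_sum[OF _ vB]) auto
    also have "(\<Sum>i\<in>UNIV. (1 / ?d) *\<^sub>R (complex_of_real (2 * ?d) * w $ i *s column i P)) = 2 *\<^sub>R (P *v w)"
      by (simp add: matrix_mult_sum scaleR_right.sum of_real_vsmult[symmetric] vector_smult_assoc)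
        (simp add: vec_eq_iff sum_distrib_left mult.assoc)
    finally have "z + 1 *s (2 *\<^sub>R (P *v w)) \<in> closure \<Omega>"
      unfolding B_def disc_dirs_def by (metis (mono_tags, lifting) mem_Collect_eq norm_one order_refl)
    then have "z + 2 *\<^sub>R (P *v w) \<in> closure \<Omega>" by simp
    from convex_open_closure_shrink[OF properly_convexD(1,2)[OF \<Omega>] z this, of "1/2"]
    show "z + P *v w \<in> \<Omega>" by (simp add: scaleR_diff_right scaleR_2 add.commute)
  qed
qed

section \<open>Minkowski functionals\<close>

definition gauge_fun :: "'a::real_vector set \<Rightarrow> 'a \<Rightarrow> real" where
  "gauge_fun S x = Inf {t. 0 < t \<and> (1 / t) *\<^sub>R x \<in> S}"

text \<open>The radius \<open>r\<close> is a parameter because it controls the functional whatever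
  the set is: all sets with the same \<open>r\<close> have functionals with the common Lipschitz
  constant \<open>1 / r\<close>, as needed for the compactness of sequences of sets.\<close>

locale convex_nhd =
  fixes S :: "'a::euclidean_space set" and r :: real
  assumes open_S: "open S" and convex_S: "convex S" and r_pos: "0 < r" and ball_S: "ball 0 r \<subseteq> S"
begin

lemma zero_mem: "0 \<in> S" using ball_S r_pos by auto

lemma scale_mono:
  assumes "(1 / t) *\<^sub>R x \<in> S" "0 < t" "t \<le> s"
  shows "(1 / s) *\<^sub>R x \<in> S"
proof -
  have "(t / s) *\<^sub>R ((1 / t) *\<^sub>R x) + (1 - t / s) *\<^sub>R 0 \<in> S"
    by (rule convexD[OF convex_S assms(1) zero_mem]) (use assms in auto)
  then show ?thesis using assms by simp
qed

text \<open>Openness of \<open>S\<close> makes the inequality strict: if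
  \<open>(1 / s) *\<^sub>R x\<close> lies in \<open>S\<close>, so does
  \<open>(1 / t) *\<^sub>R x\<close> for some \<open>t < s\<close>, hence the infimum is never
  attained.\<close>

lemma gauge_less_iff:
  assumes "0 < s"
  shows "gauge_fun S x < s \<longleftrightarrow> (1 / s) *\<^sub>R x \<in> S"
proof
  let ?T = "{t. 0 < t \<and> (1 / t) *\<^sub>R x \<in> S}"
  have bdd: "bdd_below ?T" by (rule bdd_belowI[of _ 0]) auto
  {
    assume "gauge_fun S x < s"
    moreover have "?T \<noteq> {}"
    proof -
      have "norm ((1 / (norm x / r + 1)) *\<^sub>R x) = norm x / (norm x / r + 1)"
        using r_pos by (simp add: add_nonneg_pos)
      also have "\<dots> < r" using r_pos
        by (smt (verit) divide_less_eq distrib_left mult.commute nonzero_eq_divide_eq norm_ge_zero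
            divide_nonneg_pos)
      finally have "(1 / (norm x / r + 1)) *\<^sub>R x \<in> S" using ball_S by auto
      moreover have "0 < norm x / r + 1" using r_pos by (simp add: add_nonneg_pos)
      ultimately show ?thesis by blast
    qed
    ultimately obtain t where "t \<in> ?T" "t < s" unfolding gauge_fun_def by (meson cInf_lessD)
    then show "(1 / s) *\<^sub>R x \<in> S" using scale_mono[of t x s] by auto
  }
  assume s: "(1 / s) *\<^sub>R x \<in> S"
  have "((\<lambda>t. (1 / t) *\<^sub>R x) \<longlongrightarrow> (1 / s) *\<^sub>R x) (at_left s)"
    using assms by (intro tendsto_intros) auto
  then have "\<forall>\<^sub>F t in at_left s. (1 / t) *\<^sub>R x \<in> S"
    by (rule topological_tendstoD[OF _ open_S s])
  moreover have "\<forall>\<^sub>F t in at_left s. t \<in> {0<..<s}"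
    by (rule eventually_at_leftI[of 0]) (use assms in auto)
  ultimately have "\<forall>\<^sub>F t in at_left s. (1 / t) *\<^sub>R x \<in> S \<and> t \<in> {0<..<s}" by eventually_elim auto
  then obtain t where t: "(1 / t) *\<^sub>R x \<in> S" "0 < t" "t < s"
    using eventually_happens[OF _ ] trivial_limit_at_left_real by fastforce
  then have "gauge_fun S x \<le> t" unfolding gauge_fun_def by (intro cInf_lower bdd) auto
  then show "gauge_fun S x < s" using t by simp
qed

lemma gauge_nonneg: "0 \<le> gauge_fun S x"
proof -
  have "{t. 0 < t \<and> (1 / t) *\<^sub>R x \<in> S} \<noteq> {}"
  proof -
    have "0 < \<bar>gauge_fun S x\<bar> + 1" "gauge_fun S x < \<bar>gauge_fun S x\<bar> + 1" by linarith+
    then show ?thesis using gauge_less_iff[of "\<bar>gauge_fun S x\<bar> + 1" x] by blast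
  qed
  then show ?thesis unfolding gauge_fun_def by (intro cInf_greatest) auto
qed

lemma mem_iff_gauge: "x \<in> S \<longleftrightarrow> gauge_fun S x < 1"
  using gauge_less_iff[of 1 x] by simp

lemma gauge_le_norm: "gauge_fun S x \<le> norm x / r"
proof (rule field_le_epsilon)
  fix e :: real assume e: "e > 0"
  have p: "norm x / r + e > 0" using r_pos e by (simp add: add_nonneg_pos)
  have "norm ((1 / (norm x / r + e)) *\<^sub>R x) = norm x / (norm x / r + e)"
    using p by simp
  also have "\<dots> < r" using p r_pos e by (simp add: divide_less_eq) (simp add: field_simps)
  finally have "(1 / (norm x / r + e)) *\<^sub>R x \<in> S" using ball_S by auto
  then show "gauge_fun S x \<le> norm x / r + e" using gauge_less_iff[OF p, of x] by simp
qed

lemma gauge_scale: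
  assumes "0 < c" shows "gauge_fun S (c *\<^sub>R x) = c * gauge_fun S x"
proof -
  \<comment> \<open>Two nonnegative numbers with the same positive strict upper bounds
    agree.\<close>
  have *: "gauge_fun S (c *\<^sub>R x) < s \<longleftrightarrow> c * gauge_fun S x < s" if "s > 0" for s
  proof -
    have "gauge_fun S (c *\<^sub>R x) < s \<longleftrightarrow> (1 / (s / c)) *\<^sub>R x \<in> S"
      using gauge_less_iff[OF that] by simp
    also have "\<dots> \<longleftrightarrow> gauge_fun S x < s / c" using that assms by (subst gauge_less_iff) auto
    finally show ?thesis using assms by (simp add: field_simps)
  qed
  show ?thesis
  proof (rule ccontr)
    assume "gauge_fun S (c *\<^sub>R x) \<noteq> c * gauge_fun S x"
    then have "gauge_fun S (c *\<^sub>R x) < c * gauge_fun S x \<or> c * gauge_fun S x < gauge_fun S (c *\<^sub>R x)" by linarith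
    then show False
      using *[of "gauge_fun S (c *\<^sub>R x)"] *[of "c * gauge_fun S x"]
        gauge_nonneg[of x] gauge_nonneg[of "c *\<^sub>R x"] assms
      by (smt (verit) mult_nonneg_nonneg)
  qed
qed

lemma gauge_triangle: "gauge_fun S (x + y) \<le> gauge_fun S x + gauge_fun S y"
proof (rule field_le_epsilon)
  fix e :: real assume e: "e > 0"
  define s t where "s = gauge_fun S x + e / 2" and "t = gauge_fun S y + e / 2"
  have st: "0 < s" "0 < t" using e gauge_nonneg[of x] gauge_nonneg[of y] by (auto simp: s_def t_def)
  have "(1 / s) *\<^sub>R x \<in> S" "(1 / t) *\<^sub>R y \<in> S"
    using gauge_less_iff[OF st(1), of x] gauge_less_iff[OF st(2), of y] e by (auto simp: s_def t_def)
  then have "(s / (s + t)) *\<^sub>R ((1 / s) *\<^sub>R x) + (t / (s + t)) *\<^sub>R ((1 / t) *\<^sub>R y) \<in> S"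
    by (rule convexD[OF convex_S]) (use st in \<open>auto simp flip: add_divide_distrib\<close>)
  then have "(1 / (s + t)) *\<^sub>R (x + y) \<in> S" using st by (simp add: scaleR_add_right)
  then show "gauge_fun S (x + y) \<le> gauge_fun S x + gauge_fun S y + e"
    using gauge_less_iff[of "s + t" "x + y"] st by (simp add: s_def t_def)
qed

lemma gauge_lipschitz: "\<bar>gauge_fun S x - gauge_fun S y\<bar> \<le> norm (x - y) / r"
  using gauge_triangle[of "x - y" y] gauge_triangle[of "y - x" x]
    gauge_le_norm[of "x - y"] gauge_le_norm[of "y - x"]
  by (simp add: norm_minus_commute abs_le_iff)

lemma mem_closure_iff_gauge: "x \<in> closure S \<longleftrightarrow> gauge_fun S x \<le> 1"
proof
  assume x: "x \<in> closure S"
  show "gauge_fun S x \<le> 1"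
  proof (rule field_le_epsilon)
    fix e :: real assume e: "e > 0"
    have "x + (1 - 1 / (1 + e)) *\<^sub>R (0 - x) \<in> S"
      using e by (intro convex_open_closure_shrink open_S convex_S zero_mem x) auto
    then have "(1 / (1 + e)) *\<^sub>R x \<in> S" by (simp add: algebra_simps)
    then show "gauge_fun S x \<le> 1 + e" using gauge_less_iff[of "1 + e" x] e by simp
  qed
next
  assume x: "gauge_fun S x \<le> 1"
  show "x \<in> closure S"
  proof (rule Lim_in_closed_set[OF closed_closure])
    have "(1 / (1 + 1 / real (Suc n))) *\<^sub>R x \<in> S" for n
      using x by (subst gauge_less_iff[symmetric]) (auto intro: le_less_trans add_pos_pos)
    then show "\<forall>\<^sub>F n in sequentially. (1 / (1 + 1 / real (Suc n))) *\<^sub>R x \<in> closure S"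
      using closure_subset by (intro always_eventually) blast
    have "(\<lambda>n. (1 / (1 + 1 / real (Suc n))) *\<^sub>R x) \<longlonglongrightarrow> (1 / (1 + 0)) *\<^sub>R x"
      by (intro tendsto_intros LIMSEQ_Suc[OF lim_1_over_n]) auto
    then show "(\<lambda>n. (1 / (1 + 1 / real (Suc n))) *\<^sub>R x) \<longlonglongrightarrow> x" by simp
  qed simp
qed

end

section \<open>Compactness of normalised domains\<close>

text \<open>The common radius makes the gauges bounded and equicontinuous on the unit ball, so
  Arzela-Ascoli gives a limit. Sublinearity survives in the limit, whose sublevel set
  \<open>D\<close> is again an open convex neighbourhood of 0 with the limit as its gauge.\<close>

lemma convex_nhd_compactness:
  fixes S :: "nat \<Rightarrow> 'a::euclidean_space set"
  assumes S: "\<And>n. convex_nhd (S n) r"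
  obtains D k where "strict_mono (k :: nat \<Rightarrow> nat)" "convex_nhd D r"
    "\<And>e. e > 0 \<Longrightarrow> \<exists>N. \<forall>n\<ge>N. \<forall>x. \<bar>gauge_fun (S (k n)) x - gauge_fun D x\<bar> \<le> e * norm x"
proof -
  define F where "F n = gauge_fun (S n)" for n
  have r: "0 < r" using S[of 0] by (simp add: convex_nhd_def)
  have lip: "\<bar>F n x - F n y\<bar> \<le> norm (x - y) / r" for n x y
    unfolding F_def by (rule convex_nhd.gauge_lipschitz[OF S])
  have nonneg: "0 \<le> F n x" for n x unfolding F_def by (rule convex_nhd.gauge_nonneg[OF S])
  have le: "F n x \<le> norm x / r" for n x unfolding F_def by (rule convex_nhd.gauge_le_norm[OF S])
  have scale: "F n (c *\<^sub>R x) = c * F n x" if "c > 0" for n c x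
    unfolding F_def by (rule convex_nhd.gauge_scale[OF S that])
  obtain g k where k: "strict_mono (k :: nat \<Rightarrow> nat)" and
    g: "\<And>e. 0 < e \<Longrightarrow> \<exists>N. \<forall>n x. n \<ge> N \<and> x \<in> cball 0 1 \<longrightarrow> norm (F (k n) x - g x) < e"
  proof (rule Arzela_Ascoli[of "cball (0::'a) 1" F "1 / r"])
    show "norm (F n x) \<le> 1 / r" if "x \<in> cball 0 1" for n x
    proof -
      have "norm x / r \<le> 1 / r" using that r by (intro divide_right_mono) auto
      then show ?thesis using le[of n x] nonneg[of n x] by simp
    qed
    show "\<exists>d. 0 < d \<and> (\<forall>n y. y \<in> cball 0 1 \<and> norm (x - y) < d \<longrightarrow> norm (F n x - F n y) < e)"
      if "x \<in> cball 0 1" "0 < e" for x e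
    proof (intro exI[of _ "e * r"] conjI allI impI)
      show "0 < e * r" using that r by simp
      fix n y assume "y \<in> cball 0 1 \<and> norm (x - y) < e * r"
      then have "norm (x - y) / r < e" using r by (simp add: field_simps)
      then show "norm (F n x - F n y) < e" using lip[of n x y] by simp
    qed
  qed (auto intro: that)
  \<comment> \<open>The limit \<open>g\<close> exists on the unit ball only; \<open>G\<close>
    extends it from the unit sphere by homogeneity, which is why the errors are relative to
    \<open>norm x\<close>.\<close>
  define G where "G x = norm x * g ((1 / norm x) *\<^sub>R x)" for x
  have F0: "F n 0 = 0" for n using le[of n 0] nonneg[of n 0] by simp
  have G: "\<exists>N. \<forall>n\<ge>N. \<forall>x. \<bar>F (k n) x - G x\<bar> \<le> e * norm x" if e: "e > 0" for e
  proof -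
    obtain N where N: "\<And>n x. n \<ge> N \<Longrightarrow> norm x \<le> 1 \<Longrightarrow> norm (F (k n) x - g x) < e"
      using g[OF e] by auto
    have "\<bar>F (k n) x - G x\<bar> \<le> e * norm x" if "n \<ge> N" for n x
    proof (cases "x = 0")
      case True then show ?thesis by (simp add: F0 G_def)
    next
      case False
      have "F (k n) x = F (k n) (norm x *\<^sub>R ((1 / norm x) *\<^sub>R x))" using False by simp
      also have "\<dots> = norm x * F (k n) ((1 / norm x) *\<^sub>R x)" using False by (intro scale) simp
      finally have "F (k n) x - G x = norm x * (F (k n) ((1 / norm x) *\<^sub>R x) - g ((1 / norm x) *\<^sub>R x))"
        by (simp add: G_def right_diff_distrib)
      then have "\<bar>F (k n) x - G x\<bar> = norm x * \<bar>F (k n) ((1 / norm x) *\<^sub>R x) - g ((1 / norm x) *\<^sub>R x)\<bar>"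
        by (simp add: abs_mult)
      also have "\<dots> \<le> norm x * e"
        using N[OF that, of "(1 / norm x) *\<^sub>R x"] False by (intro mult_left_mono) auto
      finally show ?thesis by (simp add: mult.commute)
    qed
    then show ?thesis by blast
  qed
  have lim: "(\<lambda>n. F (k n) x) \<longlonglongrightarrow> G x" for x
  proof (rule LIMSEQ_I)
    fix e :: real assume e: "e > 0"
    define e' where "e' = e / (norm x + 1)"
    have e': "e' > 0" using e by (simp add: e'_def add_nonneg_pos)
    have "e' * norm x < e' * (norm x + 1)" using e' by simp
    also have "\<dots> = e" by (simp add: e'_def) (metis add_nonneg_eq_0_iff norm_ge_zero zero_le_one zero_neq_one)
    finally have "e' * norm x < e" .
    then show "\<exists>N. \<forall>n\<ge>N. norm (F (k n) x - G x) < e"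
      using G[OF e'] by (metis order_le_less_trans real_norm_def)
  qed
  have Gtri: "G (x + y) \<le> G x + G y" for x y
    by (rule LIMSEQ_le[OF lim tendsto_add[OF lim lim]])
      (auto simp: F_def intro!: convex_nhd.gauge_triangle[OF S])
  have Gscale: "G (c *\<^sub>R x) = c * G x" if "c > 0" for c x
    using LIMSEQ_unique[OF lim[of "c *\<^sub>R x"] tendsto_mult_left[OF lim[of x], of c, folded scale[OF that]]]
    by simp
  have Gnonneg: "0 \<le> G x" for x by (rule LIMSEQ_le_const[OF lim]) (auto simp: nonneg)
  have Gle: "G x \<le> norm x / r" for x by (rule LIMSEQ_le_const2[OF lim]) (auto simp: le)
  have Glip: "\<bar>G x - G y\<bar> \<le> norm (x - y) / r" for x y
    using Gtri[of "x - y" y] Gtri[of "y - x" x] Gle[of "x - y"] Gle[of "y - x"]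
    by (simp add: norm_minus_commute abs_le_iff)
  define D where "D = {x. G x < 1}"
  have Gcont: "continuous_on UNIV G"
    unfolding continuous_on_iff
  proof (intro ballI allI impI)
    fix x and e :: real assume "e > 0"
    then show "\<exists>d>0. \<forall>x'\<in>UNIV. dist x' x < d \<longrightarrow> dist (G x') (G x) < e"
      using r Glip by (intro exI[of _ "e * r"])
        (auto simp: dist_norm intro!: le_less_trans[OF Glip] simp: divide_less_eq)
  qed
  have D: "convex_nhd D r"
  proof
    show "open D" unfolding D_def by (rule open_Collect_less) (use Gcont in auto)
    show "ball 0 r \<subseteq> D"
    proof
      fix x :: 'a assume "x \<in> ball 0 r"
      then have "norm x / r < 1" using r by simp
      then show "x \<in> D" using Gle[of x] by (simp add: D_def)
    qed
    have G0: "G 0 = 0" using Gle[of 0] Gnonneg[of 0] by simp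
    have Gs: "G (c *\<^sub>R x) = c * G x" if "c \<ge> 0" for c x
      using that Gscale[of c x] G0 by (cases "c = 0") auto
    show "convex D"
    proof (rule convexI)
      fix x y u v assume a: "x \<in> D" "y \<in> D" "0 \<le> (u::real)" "0 \<le> v" "u + v = 1"
      have "G (u *\<^sub>R x + v *\<^sub>R y) \<le> u * G x + v * G y" using Gtri Gs a by metis
      also have "\<dots> < 1"
        using a convex_bound_lt[of "G x" 1 "G y" u v] by (simp add: D_def)
      finally show "u *\<^sub>R x + v *\<^sub>R y \<in> D" by (simp add: D_def)
    qed
  qed (rule r)
  have "gauge_fun D x = G x" for x
  proof -
    have *: "gauge_fun D x < s \<longleftrightarrow> G x < s" if "s > 0" for s
      using convex_nhd.gauge_less_iff[OF D that, of x] Gscale[of "1 / s" x] that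
      by (simp add: D_def divide_less_eq)
    show ?thesis
      using *[of "gauge_fun D x"] *[of "G x"] Gnonneg[of x] convex_nhd.gauge_nonneg[OF D, of x]
      by linarith
  qed
  with G show thesis using k D by (intro that[of k D]) (auto simp: F_def)
qed

lemma hausdorff_dist_le:
  assumes "\<And>a. a \<in> A \<Longrightarrow> \<exists>b\<in>B. dist a b \<le> e" "\<And>b. b \<in> B \<Longrightarrow> \<exists>a\<in>A. dist a b \<le> e"
  shows "hausdorff_dist A B \<le> ennreal e"
  unfolding hausdorff_dist_def
proof (intro max.boundedI SUP_least)
  show "(INF b\<in>B. ennreal (dist a b)) \<le> ennreal e" if "a \<in> A" for a
    using assms(1)[OF that] by (meson INF_lower2 ennreal_leI)
  show "(INF a\<in>A. ennreal (dist a b)) \<le> ennreal e" if "b \<in> B" for b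
    using assms(2)[OF that] by (meson INF_lower2 ennreal_leI)
qed

text \<open>On the ball of radius \<open>R\<close> the gauges differ by at most
  \<open>e * R\<close>, so shrinking \<open>a\<close> by \<open>1 / (1 + e * R)\<close> brings it
  into the closure of \<open>T\<close>. Shrinking towards 0 never leaves the ball, so truncating
  both closures does no harm.\<close>

lemma gauge_close_imp_near:
  assumes S: "convex_nhd S r" and T: "convex_nhd T r"
    and close: "\<And>x. \<bar>gauge_fun S x - gauge_fun T x\<bar> \<le> e * norm x"
    and e: "0 \<le> e" and R: "0 < R" and a: "a \<in> closure S \<inter> cball 0 R"
  shows "\<exists>b\<in>closure T \<inter> cball 0 R. dist a b \<le> e * R * R"
proof -
  define c where "c = 1 / (1 + e * R)"
  have eR: "0 \<le> e * R" using e R by simp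
  then have c: "0 < c" "c \<le> 1" by (auto simp: c_def)
  have "gauge_fun T a \<le> gauge_fun S a + e * norm a" using close[of a] by simp
  also have "\<dots> \<le> 1 + e * R"
    using a convex_nhd.mem_closure_iff_gauge[OF S, of a] e by (intro add_mono mult_left_mono) auto
  finally have "c * gauge_fun T a \<le> 1" using eR by (simp add: c_def divide_le_eq)
  then have 1: "c *\<^sub>R a \<in> closure T"
    by (simp add: convex_nhd.mem_closure_iff_gauge[OF T] convex_nhd.gauge_scale[OF T c(1)])
  have "norm (c *\<^sub>R a) \<le> 1 * R" using c a by (simp only: norm_scaleR, intro mult_mono) auto
  then have 2: "c *\<^sub>R a \<in> cball 0 R" by simp
  have "a - c *\<^sub>R a = (1 - c) *\<^sub>R a" by (simp add: algebra_simps)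
  then have "dist a (c *\<^sub>R a) = (1 - c) * norm a" using c by (simp add: dist_norm)
  also have "\<dots> \<le> (e * R) * R"
  proof (intro mult_mono)
    have "1 - c = (e * R) / (1 + e * R)" using eR by (simp add: c_def field_simps)
    also have "\<dots> \<le> (e * R) / 1" using eR by (intro divide_left_mono) auto
    finally show "1 - c \<le> e * R" by simp
  qed (use a eR in auto)
  finally show ?thesis using 1 2 by blast
qed

lemma local_hausdorff_tendsto_gauge:
  assumes S: "\<And>n. convex_nhd (S n) r" and D: "convex_nhd D r"
    and lim: "\<And>e. e > 0 \<Longrightarrow> \<exists>N. \<forall>n\<ge>N. \<forall>x. \<bar>gauge_fun (S n) x - gauge_fun D x\<bar> \<le> e * norm x"
  shows "local_hausdorff_tendsto S D"
  unfolding local_hausdorff_tendsto_def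
proof (intro exI[of _ 1] conjI allI impI)
  fix R :: real assume "1 \<le> R"
  then have R: "0 < R" by simp
  have "\<forall>\<^sub>F n in sequentially. hausdorff_dist (closure (S n) \<inter> closure (ball 0 R))
      (closure D \<inter> closure (ball 0 R)) < u" if u: "0 < u" for u :: ennreal
  proof -
    \<comment> \<open>\<open>v\<close> is finite even if \<open>u\<close> is infinite, so it comes
      from a real tolerance.\<close>
    obtain v where v: "0 < v" "v < u" using dense u by blast
    have "v < top" using v(2) top_greatest less_le_trans by blast
    define e where "e = enn2real v"
    have e: "v = ennreal e" "e > 0" using v(1) \<open>v < top\<close> by (auto simp: e_def enn2real_positive_iff)
    have "e / (R * R) > 0" using e R by simp
    from lim[OF this] obtain N where
      N: "\<And>n x. n \<ge> N \<Longrightarrow> \<bar>gauge_fun (S n) x - gauge_fun D x\<bar> \<le> e / (R * R) * norm x" by blast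
    have "hausdorff_dist (closure (S n) \<inter> cball 0 R) (closure D \<inter> cball 0 R) \<le> ennreal e"
      if "n \<ge> N" for n
    proof (rule hausdorff_dist_le)
      show "\<exists>b\<in>closure D \<inter> cball 0 R. dist a b \<le> e" if "a \<in> closure (S n) \<inter> cball 0 R" for a
        using gauge_close_imp_near[OF S D N[OF \<open>n \<ge> N\<close>] _ R that] e R by simp
      show "\<exists>a\<in>closure (S n) \<inter> cball 0 R. dist a b \<le> e" if "b \<in> closure D \<inter> cball 0 R" for b
        using gauge_close_imp_near[OF D S[of n] _ _ R that, of "e / (R * R)"] N[OF \<open>n \<ge> N\<close>] e R
        by (simp add: dist_commute abs_minus_commute)
    qed
    then show ?thesis
      using v e R by (auto simp: eventually_sequentially intro: le_less_trans)
  qed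
  then show "(\<lambda>n. hausdorff_dist (closure (S n) \<inter> closure (ball 0 R))
      (closure D \<inter> closure (ball 0 R))) \<longlonglongrightarrow> 0"
    by (intro order_tendstoI) auto
qed simp

text \<open>Sets and points move together here; this is how being inside or outside the rescaled
  domains passes to the limit domain.\<close>

lemma gauge_tendsto:
  assumes S: "\<And>n. convex_nhd (S n) r" and D: "convex_nhd D r"
    and lim: "\<And>e. e > 0 \<Longrightarrow> \<exists>N. \<forall>n\<ge>N. \<forall>x. \<bar>gauge_fun (S n) x - gauge_fun D x\<bar> \<le> e * norm x"
    and x: "x \<longlonglongrightarrow> y"
  shows "(\<lambda>n. gauge_fun (S n) (x n)) \<longlonglongrightarrow> gauge_fun D y"
proof -
  have r: "r > 0" using D by (simp add: convex_nhd_def)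
  obtain B where B: "B > 0" "\<And>n. norm (x n) \<le> B"
    using x convergent_imp_Bseq[of x] unfolding convergent_def Bseq_def by blast
  have "(\<lambda>n. gauge_fun (S n) (x n) - gauge_fun D (x n)) \<longlonglongrightarrow> 0"
  proof (rule LIMSEQ_I)
    fix e :: real assume e: "e > 0"
    then have "e / (2 * B) > 0" using B by simp
    from lim[OF this] obtain N where
      N: "\<And>n x. n \<ge> N \<Longrightarrow> \<bar>gauge_fun (S n) x - gauge_fun D x\<bar> \<le> e / (2 * B) * norm x" by blast
    have "norm (gauge_fun (S n) (x n) - gauge_fun D (x n) - 0) < e" if "n \<ge> N" for n
    proof -
      have "e / (2 * B) * norm (x n) \<le> e / (2 * B) * B" using B e by (intro mult_left_mono) auto
      also have "\<dots> < e" using B e by simp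
      finally show ?thesis using N[OF that, of "x n"] by simp
    qed
    then show "\<exists>N. \<forall>n\<ge>N. norm (gauge_fun (S n) (x n) - gauge_fun D (x n) - 0) < e" by blast
  qed
  moreover have "(\<lambda>n. gauge_fun D (x n)) \<longlonglongrightarrow> gauge_fun D y"
  proof (rule LIM_zero_cancel, rule Lim_null_comparison)
    show "\<forall>\<^sub>F n in sequentially. norm (gauge_fun D (x n) - gauge_fun D y) \<le> norm (x n - y) / r"
      using convex_nhd.gauge_lipschitz[OF D] by simp
    have "(\<lambda>n. norm (x n - y) / r) \<longlonglongrightarrow> norm (y - y) / r"
      using x r by (intro tendsto_intros) auto
    then show "(\<lambda>n. norm (x n - y) / r) \<longlonglongrightarrow> 0" by simp
  qed
  ultimately show ?thesis using tendsto_add[of _ 0 _ _ "gauge_fun D y"] by force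
qed

lemma disc_dirs_chart:
  fixes P :: "complex ^ 'd ^ 'd"
  shows "u \<in> disc_dirs {w. z + P *v w \<in> \<Omega>} q \<longleftrightarrow> P *v u \<in> disc_dirs \<Omega> (z + P *v q)"
  by (simp add: disc_dirs_def matrix_vector_right_distrib vector_scalar_commute add.assoc)

text \<open>The homothety with centre \<open>x\<close> and ratio \<open>t\<close> maps
  \<open>cball p r\<close> onto this ball, so inscribed balls grow linearly along the segment to
  \<open>p\<close>.\<close>

lemma frontier_cone:
  fixes \<Omega> :: "'a::euclidean_space set"
  assumes \<Omega>: "open \<Omega>" "convex \<Omega>" and r: "cball p r \<subseteq> \<Omega>"
    and x: "x \<in> closure \<Omega>" and t: "0 < t" "t \<le> 1"
  shows "cball (x + t *\<^sub>R (p - x)) (t * r) \<subseteq> \<Omega>"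
proof
  fix y assume y: "y \<in> cball (x + t *\<^sub>R (p - x)) (t * r)"
  define q where "q = p + (1 / t) *\<^sub>R (y - (x + t *\<^sub>R (p - x)))"
  have "dist p q = norm (y - (x + t *\<^sub>R (p - x))) / t" using t by (simp add: q_def dist_norm)
  also have "\<dots> \<le> r" using y t by (simp add: dist_norm norm_minus_commute divide_le_eq mult.commute)
  finally have "q \<in> \<Omega>" using r by auto
  from convex_open_closure_shrink[OF \<Omega> this x t] have "x + t *\<^sub>R (q - x) \<in> \<Omega>" .
  also have "x + t *\<^sub>R (q - x) = y" using t by (simp add: q_def algebra_simps)
  finally show "y \<in> \<Omega>" .
qed

text \<open>
  Were there no such \<open>L\<close>, rescaling around the points \<open>x + (L * t) *\<^sub>R (p - x)\<close> by Auerbach bases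
  would produce, as \<open>L\<close> tends to infinity, a domain in the orbit closure with a disc in its boundary.
\<close>

lemma disc_dirs_doubling:
  fixes \<Omega> :: "(complex ^ 'd) set"
  assumes \<Omega>: "\<Omega> \<in> properly_convex_domains"
    and simple: "\<And>D. D \<in> affine_orbit_closure \<Omega> \<Longrightarrow> simple_boundary D"
    and p: "p \<in> \<Omega>" and R: "R > 0"
  obtains L :: nat where "L \<ge> 2"
    "\<And>x t v. x \<in> frontier \<Omega> \<Longrightarrow> dist x p \<le> R \<Longrightarrow> 0 < t \<Longrightarrow> real L * t \<le> 1 \<Longrightarrow>
       v \<in> disc_dirs \<Omega> (x + t *\<^sub>R (p - x)) \<Longrightarrow>
       2 *\<^sub>R v \<in> disc_dirs \<Omega> (x + (real L * t) *\<^sub>R (p - x))"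
proof (rule ccontr)
  note witness = that
  assume no: "\<not> thesis"
  note op = properly_convexD(1)[OF \<Omega>] and cv = properly_convexD(2)[OF \<Omega>]
  obtain r0 where r0: "r0 > 0" "cball p r0 \<subseteq> \<Omega>" using op p open_contains_cball by blast
  have "\<exists>x t v. x \<in> frontier \<Omega> \<and> dist x p \<le> R \<and> 0 < t \<and> real L * t \<le> 1 \<and>
       v \<in> disc_dirs \<Omega> (x + t *\<^sub>R (p - x)) \<and>
       2 *\<^sub>R v \<notin> disc_dirs \<Omega> (x + (real L * t) *\<^sub>R (p - x))" if "L \<ge> 2" for L :: nat
    using no witness[OF that] by metis
  then have "\<forall>n. \<exists>x t v. x \<in> frontier \<Omega> \<and> dist x p \<le> R \<and> 0 < t \<and> real (n + 2) * t \<le> 1 \<and>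
       v \<in> disc_dirs \<Omega> (x + t *\<^sub>R (p - x)) \<and>
       2 *\<^sub>R v \<notin> disc_dirs \<Omega> (x + (real (n + 2) * t) *\<^sub>R (p - x))"
    by (metis le_add2)
  then obtain x t v where x: "\<And>n. x n \<in> frontier \<Omega>" "\<And>n. dist (x n) p \<le> R"
    and t: "\<And>n. 0 < t n" "\<And>n. real (n + 2) * t n \<le> 1"
    and v: "\<And>n. v n \<in> disc_dirs \<Omega> (x n + t n *\<^sub>R (p - x n))"
       "\<And>n. 2 *\<^sub>R v n \<notin> disc_dirs \<Omega> (x n + (real (n + 2) * t n) *\<^sub>R (p - x n))"
    by metis
  \<comment> \<open>The far point, at which \<Omega> is normalised; \<open>n + 2\<close> plays the
    role of \<open>L\<close>.\<close>
  define z where "z n = x n + (real (n + 2) * t n) *\<^sub>R (p - x n)" for n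
  have xcl: "x n \<in> closure \<Omega>" for n using x(1) by (simp add: frontier_def)
  have cone: "cball (z n) (real (n + 2) * t n * r0) \<subseteq> \<Omega>" for n
    unfolding z_def using t by (intro frontier_cone op cv r0 xcl) (auto intro!: mult_pos_pos)
  have z: "z n \<in> \<Omega>" for n using cone[of n] t(1)[of n] r0 by (auto simp: subset_iff)
  define d where "d = real CARD('d)"
  have d: "d > 0" by (simp add: d_def)
  define r where "r = 1 / (2 * d)"
  have r: "r > 0" using d by (simp add: r_def)
  have "\<forall>n. \<exists>P :: complex ^ 'd ^ 'd. invertible P \<and> (\<forall>w. norm w \<le> r \<longrightarrow> z n + P *v w \<in> \<Omega>) \<and>
      (\<forall>u. P *v u \<in> disc_dirs \<Omega> (z n) \<longrightarrow> (\<forall>i. cmod (u $ i) \<le> 1))"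
    unfolding r_def d_def by (meson disc_dirs_Auerbach[OF \<Omega> z])
  then obtain P :: "nat \<Rightarrow> complex ^ 'd ^ 'd" where inv: "\<And>n. invertible (P n)"
    and Pball: "\<And>n w. norm w \<le> r \<Longrightarrow> z n + P n *v w \<in> \<Omega>"
    and Pdisc: "\<And>n u i. P n *v u \<in> disc_dirs \<Omega> (z n) \<Longrightarrow> cmod (u $ i) \<le> 1"
    by metis
  have "\<forall>n. \<exists>N. P n ** N = mat 1 \<and> N ** P n = mat 1" using inv unfolding invertible_def by blast
  then obtain N where N: "\<And>n. P n ** N n = mat 1" "\<And>n. N n ** P n = mat 1" by metis
  have PN: "P n *v (N n *v w) = w" "N n *v (P n *v w) = w" for n w
    by (simp_all add: matrix_vector_mul_assoc N)
  define S where "S n = {w. z n + P n *v w \<in> \<Omega>}" for n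
  define A where "A n = (\<lambda>w. N n *v w + - (N n *v z n))" for n
  have AS: "A n ` \<Omega> = S n" for n
  proof
    show "A n ` \<Omega> \<subseteq> S n"
      by (auto simp: A_def S_def matrix_vector_mult_diff_distrib PN)
    show "S n \<subseteq> A n ` \<Omega>"
    proof
      fix w assume "w \<in> S n"
      then have "z n + P n *v w \<in> \<Omega>" by (simp add: S_def)
      moreover have "w = A n (z n + P n *v w)" by (simp add: A_def matrix_vector_right_distrib PN)
      ultimately show "w \<in> A n ` \<Omega>" by blast
    qed
  qed
  have Aaff: "A n \<in> affine_automorphisms" for n
  proof -
    have "invertible (N n)" unfolding invertible_def using N by blast
    then show ?thesis unfolding affine_automorphisms_def A_def by blast
  qed
  have cballS: "cball 0 r \<subseteq> S n" for n using Pball by (auto simp: S_def)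
  have nhd: "convex_nhd (S n) r" for n
  proof
    have lin: "linear (\<lambda>w. P n *v w)"
      by (rule linearI)
        (simp_all add: matrix_vector_right_distrib vector_scalar_commute flip: of_real_vsmult)
    have "continuous_on UNIV (\<lambda>w. z n + P n *v w)"
      by (intro continuous_intros linear_continuous_on linear_conv_bounded_linear[THEN iffD1] lin)
    then show "open (S n)" unfolding S_def
      using continuous_open_vimage[OF op, of "\<lambda>w. z n + P n *v w"]
      by (simp add: vimage_def continuous_on_eq_continuous_at)
    show "convex (S n)"
    proof (rule convexI)
      fix a b and u u' :: real
      assume ab: "a \<in> S n" "b \<in> S n" and u: "0 \<le> u" "0 \<le> u'" "u + u' = 1"
      have "u *\<^sub>R (z n + P n *v a) + u' *\<^sub>R (z n + P n *v b) \<in> \<Omega>"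
        using ab by (intro convexD[OF cv _ _ u]) (auto simp: S_def)
      also have "u *\<^sub>R (z n + P n *v a) + u' *\<^sub>R (z n + P n *v b)
          = (u + u') *\<^sub>R z n + P n *v (u *\<^sub>R a + u' *\<^sub>R b)"
        by (simp add: linear_add[OF lin] linear_scale[OF lin] algebra_simps)
      finally show "u *\<^sub>R a + u' *\<^sub>R b \<in> S n" using u by (simp add: S_def)
    qed
    show "ball 0 r \<subseteq> S n" using cballS[of n] by (meson ball_subset_cball order_trans)
  qed (rule r)
  have bound0: "norm u \<le> d" if "u \<in> disc_dirs (S n) 0" for u n
  proof -
    have "P n *v u \<in> disc_dirs \<Omega> (z n)" using that unfolding S_def disc_dirs_chart by simp
    from norm_le_card[OF Pdisc[OF this]] show ?thesis by (simp add: d_def)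
  qed
  have bound: "norm u \<le> d * ((Y + r) / r)" if "u \<in> disc_dirs (S n) y" "norm y \<le> Y" "Y > 0" for u n y Y
  proof -
    have "(r / (Y + r)) *\<^sub>R u \<in> disc_dirs (S n) 0"
      by (rule disc_dirs_recentre[OF convex_nhd.convex_S[OF nhd] cballS r that(3) _ that(1)])
        (use that in simp)
    from bound0[OF this] show ?thesis using r that(3) by (simp add: field_simps)
  qed
  define q where "q n = N n *v (x n - z n)" for n
  define u where "u n = N n *v v n" for n
  have zq: "z n + P n *v q n = x n" for n by (simp add: q_def PN)
  have qS: "q n \<notin> S n" for n
    using x(1)[of n] op zq[of n] by (simp add: S_def frontier_def interior_open)
  \<comment> \<open>\<Omega> contains a ball of radius \<open>real (n + 2) * t n * r0\<close> around
    \<open>z n\<close>, while \<open>x n\<close> is at distance at most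
    \<open>real (n + 2) * t n * R\<close>. So \<open>c\<close> times the vector from
    \<open>z n\<close> to \<open>x n\<close> is a disc direction, which bounds \<open>q n\<close> in
    the chart.\<close>
  define c where "c = r0 / R"
  have c: "c > 0" using r0 R by (simp add: c_def)
  have "c *\<^sub>R q n \<in> disc_dirs (S n) 0" for n
  proof -
    let ?T = "real (n + 2) * t n"
    have T: "?T > 0" using t(1)[of n] by simp
    have "norm (x n - z n) = ?T * dist (x n) p"
      using T by (simp add: z_def dist_norm norm_minus_commute)
    also have "\<dots> \<le> ?T * R" using T x(2) by (intro mult_left_mono) auto
    finally have "c * norm (x n - z n) \<le> c * (?T * R)" using c by (intro mult_left_mono) auto
    also have "\<dots> = ?T * r0" using R by (simp add: c_def)
    finally have "c *\<^sub>R (x n - z n) \<in> disc_dirs \<Omega> (z n)"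
      using c by (intro disc_dirs_if_cball[OF cone]) simp
    moreover have "P n *v (c *\<^sub>R q n) = c *\<^sub>R (x n - z n)"
      by (simp add: q_def PN vector_scalar_commute flip: of_real_vsmult)
    ultimately show ?thesis unfolding S_def disc_dirs_chart by simp
  qed
  from bound0[OF this] have qn: "norm (q n) \<le> d / c" for n
    using c by (simp add: field_simps)
  \<comment> \<open>In the chart the near point is \<open>q n\<close> times a factor tending to 1,
    so it has the same limit as \<open>q n\<close> along a convergent subsequence.\<close>
  have disc: "u n \<in> disc_dirs (S n) ((1 - 1 / real (n + 2)) *\<^sub>R q n)" for n
  proof -
    have "P n *v ((1 - 1 / real (n + 2)) *\<^sub>R q n) = (1 - 1 / real (n + 2)) *\<^sub>R (x n - z n)"
      unfolding of_real_vsmult[symmetric] vector_scalar_commute by (simp add: q_def PN)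
    then have "z n + P n *v ((1 - 1 / real (n + 2)) *\<^sub>R q n)
        = x n + (1 / real (n + 2)) *\<^sub>R (z n - x n)"
      by (simp add: algebra_simps)
    also have "\<dots> = x n + t n *\<^sub>R (p - x n)" by (simp add: z_def)
    finally show ?thesis unfolding S_def disc_dirs_chart using v(1)[of n] by (simp add: u_def PN)
  qed
  define U where "U = d * ((d / c + r) / r)"
  have "norm ((1 - 1 / real (n + 2)) *\<^sub>R q n) \<le> 1 * norm (q n)" for n
    unfolding norm_scaleR by (intro mult_right_mono) auto
  then have un: "norm (u n) \<le> U" for n
    unfolding U_def by (intro bound[OF disc]) (use qn[of n] d c in \<open>auto intro: order_trans\<close>)
  \<comment> \<open>Were \<open>u n\<close> shorter, its double would lie in the ball inscribed in
    \<open>S n\<close>, against the choice of \<open>v n\<close>. Hence the limiting disc does not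
    shrink to a point.\<close>
  have un2: "r / 2 \<le> norm (u n)" for n
  proof (rule ccontr)
    assume "\<not> ?thesis"
    then have "2 *\<^sub>R u n \<in> disc_dirs (S n) 0"
      by (intro disc_dirs_if_cball[OF cballS]) simp
    moreover have "P n *v (2 *\<^sub>R u n) = 2 *\<^sub>R v n"
      unfolding of_real_vsmult[symmetric] vector_scalar_commute by (simp add: u_def PN)
    ultimately show False using v(2)[of n] unfolding S_def disc_dirs_chart by (simp add: z_def)
  qed
  obtain D k where k: "strict_mono (k :: nat \<Rightarrow> nat)" and D: "convex_nhd D r"
    and lim: "\<And>e. e > 0 \<Longrightarrow> \<exists>N. \<forall>n\<ge>N. \<forall>x. \<bar>gauge_fun (S (k n)) x - gauge_fun D x\<bar> \<le> e * norm x"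
    by (rule convex_nhd_compactness[of S r, OF nhd]) (rule that)
  have "compact (cball (0 :: complex ^ 'd) (d / c) \<times> cball (0 :: complex ^ 'd) U)"
    by (intro compact_Times) auto
  moreover have "\<forall>n. (q (k n), u (k n)) \<in> cball 0 (d / c) \<times> cball 0 U" using qn un by simp
  ultimately obtain qu k' where k': "strict_mono (k' :: nat \<Rightarrow> nat)"
    and qu: "((\<lambda>n. (q (k n), u (k n))) \<circ> k') \<longlonglongrightarrow> qu"
    unfolding compact_def by meson
  define K where "K = k \<circ> k'"
  define q0 u0 where "q0 = fst qu" and "u0 = snd qu"
  have K: "strict_mono K" unfolding K_def using k k' by (rule strict_mono_o)
  have q0: "(\<lambda>n. q (K n)) \<longlonglongrightarrow> q0" and u0: "(\<lambda>n. u (K n)) \<longlonglongrightarrow> u0"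
    using tendsto_fst[OF qu] tendsto_snd[OF qu] by (simp_all add: K_def q0_def u0_def comp_def)
  have limK: "\<exists>N. \<forall>n\<ge>N. \<forall>x. \<bar>gauge_fun (S (K n)) x - gauge_fun D x\<bar> \<le> e * norm x" if "e > 0" for e
    using lim[OF that] seq_suble[OF k'] unfolding K_def comp_def by (meson order_trans)
  have nhdK: "convex_nhd (S (K n)) r" for n by (rule nhd)
  \<comment> \<open>A complex line in \<open>D\<close> would yield discs in \<open>S (K n)\<close>
    around \<open>(1 / 3) *\<^sub>R a\<close> that are larger than \<open>bound\<close> allows. Here
    \<open>m\<close> sets their size, and \<open>W\<close> bounds the points of the line concerned,
    so that the two gauges differ there by at most 1.\<close>
  have "D \<in> properly_convex_domains"
    unfolding properly_convex_domains_def
  proof (intro CollectI conjI notI)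
    show "open D" "convex D" using D by (auto simp: convex_nhd_def)
    show False if "D = {}" using convex_nhd.zero_mem[OF D] that by simp
    assume "\<exists>p v. v \<noteq> 0 \<and> (\<forall>\<zeta>::complex. p + \<zeta> *s v \<in> D)"
    then obtain a w where w: "w \<noteq> 0" and line: "\<And>\<zeta>::complex. a + \<zeta> *s w \<in> D" by blast
    define Y where "Y = norm a + 1"
    define m where "m = (3 * (d * ((Y + r) / r)) + 1) / norm w"
    have Y: "Y > 0" by (simp add: Y_def add_nonneg_pos)
    have m: "m > 0" unfolding m_def using w d r Y by (intro divide_pos_pos add_nonneg_pos) auto
    define W where "W = norm a + m * norm w + 1"
    have W: "W > 0" using m by (auto simp: W_def intro!: add_nonneg_pos)
    from limK[of "1 / W"] W obtain n where
      n: "\<And>x. \<bar>gauge_fun (S (K n)) x - gauge_fun D x\<bar> \<le> 1 / W * norm x" by auto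
    have "(m / 3) *\<^sub>R w \<in> disc_dirs (S (K n)) ((1 / 3) *\<^sub>R a)"
      unfolding disc_dirs_def
    proof (intro CollectI allI impI)
      fix \<zeta> :: complex assume \<zeta>: "cmod \<zeta> \<le> 1"
      let ?y = "a + (\<zeta> * complex_of_real m) *s w"
      have "norm ?y \<le> norm a + cmod (\<zeta> * complex_of_real m) * norm w"
        using norm_triangle_ineq[of a "(\<zeta> * complex_of_real m) *s w"] by (simp only: norm_vsmult)
      also have "\<dots> \<le> norm a + (1 * m) * norm w"
        using m \<zeta> unfolding norm_mult by (intro add_left_mono mult_right_mono mult_mono) auto
      also have "\<dots> \<le> W" by (simp add: W_def)
      finally have "1 / W * norm ?y \<le> 1" using W by (simp add: divide_le_eq)
      moreover have "gauge_fun D ?y < 1" using line convex_nhd.mem_iff_gauge[OF D] by blast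
      ultimately have "gauge_fun (S (K n)) ?y < 3" using n[of ?y] by linarith
      then have "(1 / 3) *\<^sub>R ?y \<in> S (K n)" using convex_nhd.gauge_less_iff[OF nhd, of 3] by simp
      also have "(1 / 3) *\<^sub>R ?y = (1 / 3) *\<^sub>R a + \<zeta> *s ((m / 3) *\<^sub>R w)"
        by (simp add: vec_eq_iff) (simp add: scaleR_conv_of_real algebra_simps)
      finally show "(1 / 3) *\<^sub>R a + \<zeta> *s ((m / 3) *\<^sub>R w) \<in> S (K n)" .
    qed
    then have "norm ((m / 3) *\<^sub>R w) \<le> d * ((Y + r) / r)"
      by (rule bound) (use Y in \<open>auto simp: Y_def\<close>)
    then have "m * norm w \<le> 3 * (d * ((Y + r) / r))" using m by (simp add: mult.commute)
    moreover have "m * norm w = 3 * (d * ((Y + r) / r)) + 1" using w by (simp add: m_def)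
    ultimately show False by linarith
  qed
  moreover have "local_hausdorff_tendsto (\<lambda>n. A (K n) ` \<Omega>) D"
    unfolding AS by (rule local_hausdorff_tendsto_gauge[OF nhdK D limK])
  ultimately have "D \<in> affine_orbit_closure \<Omega>"
    unfolding affine_orbit_closure_def
    by (intro CollectI conjI exI[of _ "\<lambda>n. A (K n)"] allI Aaff)
  then have sD: "simple_boundary D" by (rule simple)
  have "1 \<le> gauge_fun D q0"
  proof (rule LIMSEQ_le_const[OF gauge_tendsto[OF nhdK D limK q0]])
    show "\<exists>N. \<forall>n\<ge>N. 1 \<le> gauge_fun (S (K n)) (q (K n))"
      using qS convex_nhd.mem_iff_gauge[OF nhd] by (meson not_le)
  qed
  then have q0D: "q0 \<notin> D" using convex_nhd.mem_iff_gauge[OF D] by simp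
  have cl: "q0 + \<zeta> *s u0 \<in> closure D" if "cmod \<zeta> \<le> 1" for \<zeta>
  proof -
    have "(\<lambda>n. 1 / real (K n + 2)) \<longlonglongrightarrow> 0"
      using LIMSEQ_subseq_LIMSEQ[OF LIMSEQ_ignore_initial_segment[OF lim_1_over_n, of 2] K]
      by (simp add: comp_def)
    then have "(\<lambda>n. (1 - 1 / real (K n + 2)) *\<^sub>R q (K n) + \<zeta> *s u (K n)) \<longlonglongrightarrow> (1 - 0) *\<^sub>R q0 + \<zeta> *s u0"
      by (intro tendsto_intros tendsto_vsmult q0 u0)
    then have y: "(\<lambda>n. (1 - 1 / real (K n + 2)) *\<^sub>R q (K n) + \<zeta> *s u (K n)) \<longlonglongrightarrow> q0 + \<zeta> *s u0"
      by simp
    have "(1 - 1 / real (K n + 2)) *\<^sub>R q (K n) + \<zeta> *s u (K n) \<in> S (K n)" for n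
      using disc[of "K n"] that unfolding disc_dirs_def by blast
    then have "gauge_fun (S (K n)) ((1 - 1 / real (K n + 2)) *\<^sub>R q (K n) + \<zeta> *s u (K n)) \<le> 1" for n
      using convex_nhd.mem_iff_gauge[OF nhd] less_imp_le by blast
    then have "gauge_fun D (q0 + \<zeta> *s u0) \<le> 1"
      by (intro LIMSEQ_le_const2[OF gauge_tendsto[OF nhdK D limK y]]) auto
    then show ?thesis using convex_nhd.mem_closure_iff_gauge[OF D] by simp
  qed
  have opD: "open D" "convex D" using D by (auto simp: convex_nhd_def)
  \<comment> \<open>The boundary point \<open>q0\<close> is the midpoint of two opposite points of
    the disc. Both lie in the closure, so if one of them were in the open set \<open>D\<close>, then
    \<open>q0\<close> would be too.\<close>
  have "q0 + \<zeta> *s u0 \<notin> D" if "cmod \<zeta> \<le> 1" for \<zeta>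
  proof
    assume "q0 + \<zeta> *s u0 \<in> D"
    from convex_open_closure_shrink[OF opD this cl[of "- \<zeta>"], of "1/2"] that
    have "(q0 + (- \<zeta>) *s u0) + (1/2) *\<^sub>R ((q0 + \<zeta> *s u0) - (q0 + (- \<zeta>) *s u0)) \<in> D" by simp
    also have "(q0 + (- \<zeta>) *s u0) + (1/2) *\<^sub>R ((q0 + \<zeta> *s u0) - (q0 + (- \<zeta>) *s u0)) = q0"
      by (simp add: vec_eq_iff)
    finally show False using q0D by simp
  qed
  then have "holomorphic_disc (\<lambda>\<zeta>. q0 + \<zeta> *s u0) (frontier D)"
    using cl opD(1) by (auto simp: holomorphic_disc_def frontier_def interior_open intro!: holomorphic_intros)
  then have "(\<lambda>\<zeta>. q0 + \<zeta> *s u0) constant_on ball 0 1" using sD by (auto simp: simple_boundary_def)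
  then obtain y where "\<forall>\<zeta>\<in>ball 0 1. q0 + \<zeta> *s u0 = y" by (auto simp: constant_on_def)
  from bspec[OF this, of 0] bspec[OF this, of "1/2"] have "q0 + 0 *s u0 = q0 + (1/2) *s u0"
    by (simp add: norm_divide)
  then have "u0 = 0" by (simp add: vec_eq_iff)
  moreover have "r / 2 \<le> norm u0"
    by (rule LIMSEQ_le_const[OF tendsto_norm[OF u0]]) (use un2 in auto)
  ultimately show False using r by simp
qed

section \<open>Decay of discs near the boundary\<close>

text \<open>Measured to the complement rather than to the frontier, it is 0 off \<Omega>, so a
  positive value certifies membership. As \<open>infdist\<close> to the empty set is 0, several
  facts ask for \<open>- \<Omega>\<close> to be nonempty.\<close>

abbreviation bdry_dist :: "'a::metric_space set \<Rightarrow> 'a \<Rightarrow> real" where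
  "bdry_dist \<Omega> z \<equiv> infdist z (- \<Omega>)"

lemma properly_convex_not_UNIV:
  assumes "\<Omega> \<in> properly_convex_domains" shows "- \<Omega> \<noteq> {}"
proof
  assume "- \<Omega> = {}"
  then have "\<forall>\<zeta>::complex. 0 + \<zeta> *s 1 \<in> \<Omega>" by auto
  moreover have "(1 :: complex ^ 'a) \<noteq> 0" by (simp add: vec_eq_iff)
  ultimately show False using assms unfolding properly_convex_domains_def by blast
qed

lemma bdry_dist_pos:
  assumes "open \<Omega>" "- \<Omega> \<noteq> {}" "z \<in> \<Omega>" shows "0 < bdry_dist \<Omega> z"
proof -
  have "closed (- \<Omega>)" using assms by (simp add: closed_def)
  then show ?thesis using assms infdist_pos_not_in_closed[of "- \<Omega>" z] by simp
qed

lemma ball_bdry_dist: "ball z (bdry_dist \<Omega> z) \<subseteq> \<Omega>"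
proof
  fix x assume "x \<in> ball z (bdry_dist \<Omega> z)"
  then show "x \<in> \<Omega>" using infdist_le[of x "- \<Omega>" z] by (metis ComplI mem_ball not_le)
qed

lemma le_bdry_dist:
  assumes "cball z r \<subseteq> \<Omega>" "- \<Omega> \<noteq> {}" shows "r \<le> bdry_dist \<Omega> z"
proof (unfold infdist_notempty[OF assms(2)], rule cINF_greatest[OF assms(2)])
  fix y assume "y \<in> - \<Omega>"
  then have "y \<notin> cball z r" using assms(1) by blast
  then show "r \<le> dist z y" by simp
qed

text \<open>Each doubling multiplies the parameter \<open>t\<close> on the segment to
  \<open>p\<close> by \<open>L\<close>. After \<open>k\<close> doublings, with \<open>t\<close> of
  order \<open>L\<close> to the power \<open>- k\<close>, disc directions are still bounded by
  \<open>M\<close>; so \<open>norm v\<close> is at most of order 2 to the power \<open>- k\<close>,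
  a power of \<open>t\<close> whose exponent \<alpha> solves
  \<open>real L powr \<alpha> = 2\<close>.\<close>

lemma disc_dirs_Hoelder:
  fixes \<Omega> :: "(complex ^ 'd) set"
  assumes \<Omega>: "\<Omega> \<in> properly_convex_domains"
    and simple: "\<And>D. D \<in> affine_orbit_closure \<Omega> \<Longrightarrow> simple_boundary D"
  obtains C \<alpha> where "C > 0" "\<alpha> > 0"
    "\<And>z v. z \<in> \<Omega> \<Longrightarrow> norm z \<le> R \<Longrightarrow> v \<in> disc_dirs \<Omega> z \<Longrightarrow> norm v \<le> C * bdry_dist \<Omega> z powr \<alpha>"
proof -
  note op = properly_convexD(1)[OF \<Omega>] and cv = properly_convexD(2)[OF \<Omega>]
    and ne = properly_convex_not_UNIV[OF \<Omega>]
  obtain p where p: "p \<in> \<Omega>" using properly_convexD(3)[OF \<Omega>] by auto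
  obtain r where r: "r > 0" "cball p r \<subseteq> \<Omega>" using op p open_contains_cball by blast
  define R' where "R' = \<bar>R\<bar> + norm p + 1"
  have R': "R' > 0" by (auto simp: R'_def intro: add_nonneg_pos)
  obtain L :: nat where L: "L \<ge> 2" and doubling:
    "\<And>x t v. x \<in> frontier \<Omega> \<Longrightarrow> dist x p \<le> 2 * R' \<Longrightarrow> 0 < t \<Longrightarrow> real L * t \<le> 1 \<Longrightarrow>
       v \<in> disc_dirs \<Omega> (x + t *\<^sub>R (p - x)) \<Longrightarrow>
       2 *\<^sub>R v \<in> disc_dirs \<Omega> (x + (real L * t) *\<^sub>R (p - x))"
  proof (rule disc_dirs_doubling[OF \<Omega> simple p])
    show "2 * R' > 0" using R' by simp
  qed (use that in blast)+
  obtain M where M: "M > 0" "\<And>z v. norm z \<le> norm p + 2 * R' \<Longrightarrow> v \<in> disc_dirs \<Omega> z \<Longrightarrow> norm v \<le> M"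
    using disc_dirs_locally_bounded[OF \<Omega>, of "norm p + 2 * R'"] by metis
  define \<alpha> where "\<alpha> = ln 2 / ln (real L)"
  have \<alpha>: "\<alpha> > 0" using L by (simp add: \<alpha>_def)
  have L\<alpha>: "real L powr \<alpha> = 2" using L by (simp add: \<alpha>_def powr_def)
  \<comment> \<open>\<open>2 / r\<close> serves both cases: \<open>?\<delta> \<ge> r / 2\<close>
    directly, the other one through \<open>t \<le> ?\<delta> / r\<close>. The factor 2 pays for the
    last doubling, which would lead past \<open>p\<close>.\<close>
  define C where "C = 2 * M * (2 / r) powr \<alpha>"
  show thesis
  proof (rule that)
    show "C > 0" using M r by (simp add: C_def)
    show "\<alpha> > 0" by (rule \<alpha>)
    fix z v assume z: "z \<in> \<Omega>" "norm z \<le> R" and v: "v \<in> disc_dirs \<Omega> z"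
    let ?\<delta> = "bdry_dist \<Omega> z"
    have \<delta>: "?\<delta> > 0" by (rule bdry_dist_pos[OF op ne z(1)])
    have zp: "dist z p \<le> R'" using norm_triangle_ineq4[of z p] z by (simp add: R'_def dist_norm)
    show "norm v \<le> C * ?\<delta> powr \<alpha>"
    proof (cases "?\<delta> \<ge> r / 2")
      case True
      have "norm z \<le> norm p + 2 * R'" using z(2) unfolding R'_def by (smt (verit) norm_ge_zero)
      then have "norm v \<le> M * 1" using M(2) v by simp
      also have "\<dots> \<le> M * (2 * ?\<delta> / r) powr \<alpha>"
        using True r \<alpha> M by (intro mult_left_mono ge_one_powr_ge_zero) (auto simp: field_simps)
      also have "(2 * ?\<delta> / r) powr \<alpha> = (2 / r) powr \<alpha> * ?\<delta> powr \<alpha>"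
        using r \<delta> by (simp flip: powr_mult)
      also have "M * ((2 / r) powr \<alpha> * ?\<delta> powr \<alpha>) \<le> C * ?\<delta> powr \<alpha>"
        using M by (simp add: C_def)
      finally show ?thesis .
    next
      case False
      \<comment> \<open>The ray from \<open>p\<close> through \<open>z\<close> may never leave
        \<Omega>. But if the reflection \<open>y\<close> of \<open>p\<close> in \<open>z\<close>
        were in \<Omega>, a ball of radius \<open>r / 2\<close> around \<open>z\<close> would be
        too. So close to the boundary a frontier point \<open>x\<close> exists between
        \<open>z\<close> and \<open>y\<close>, at bounded distance from \<open>p\<close>.\<close>
      define y where "y = p + 2 *\<^sub>R (z - p)"
      have "y \<notin> \<Omega>"
      proof
        assume "y \<in> \<Omega>"
        then have "cball (y + (1/2) *\<^sub>R (p - y)) (1/2 * r) \<subseteq> \<Omega>"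
          using closure_subset by (intro frontier_cone[OF op cv r(2)]) auto
        moreover have "y + (1/2) *\<^sub>R (p - y) = z"
          by (simp add: y_def vec_eq_iff) (simp add: scaleR_conv_of_real field_simps)
        ultimately show False using le_bdry_dist[OF _ ne, of z "1/2 * r"] False by simp
      qed
      then have "closed_segment z y \<inter> frontier \<Omega> \<noteq> {}"
        using z(1) by (intro connected_Int_frontier) auto
      then obtain x where x: "x \<in> closed_segment z y" "x \<in> frontier \<Omega>" by blast
      then obtain s where s: "0 \<le> s" "s \<le> 1" "x = (1 - s) *\<^sub>R z + s *\<^sub>R y"
        by (auto simp: closed_segment_def)
      have xp: "x - p = (1 + s) *\<^sub>R (z - p)"
        by (simp add: s(3) y_def vec_eq_iff) (simp add: scaleR_conv_of_real algebra_simps)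
      define t where "t = s / (1 + s)"
      have zx: "z = x + t *\<^sub>R (p - x)"
      proof -
        have "x + t *\<^sub>R (p - x) = p + (1 - t) *\<^sub>R (x - p)" by (simp add: algebra_simps)
        also have "\<dots> = p + ((1 - t) * (1 + s)) *\<^sub>R (z - p)" by (simp add: xp)
        also have "(1 - t) * (1 + s) = 1" using s by (simp add: t_def field_simps)
        finally show ?thesis by simp
      qed
      have "x \<notin> \<Omega>" using x(2) op by (simp add: frontier_def interior_open)
      then have "s \<noteq> 0" using s(3) z(1) by auto
      then have t: "0 < t" "t \<le> 1" using s by (auto simp: t_def)
      have "dist x p = (1 + s) * dist z p" using xp s by (simp add: dist_norm)
      also have "\<dots> \<le> 2 * R'" using s zp R' by (intro mult_mono) auto
      finally have xR: "dist x p \<le> 2 * R'" .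
      have "cball z (t * r) \<subseteq> \<Omega>" unfolding zx
        using x(2) t by (intro frontier_cone[OF op cv r(2)]) (auto simp: frontier_def)
      from le_bdry_dist[OF this ne] have t\<delta>: "t \<le> ?\<delta> / r" using r by (simp add: field_simps)
      have "\<exists>n. 1 < real L ^ n * t"
      proof -
        obtain n where "1 / t < real L ^ n" using real_arch_pow[of "real L" "1 / t"] L by auto
        then show ?thesis using t by (auto simp: field_simps)
      qed
      then obtain k where k: "\<forall>i\<le>k. \<not> 1 < real L ^ i * t" "1 < real L ^ Suc k * t"
        using ex_least_nat_less[of "\<lambda>n. 1 < real L ^ n * t"] t by auto
      have "2 ^ i *\<^sub>R v \<in> disc_dirs \<Omega> (x + (real L ^ i * t) *\<^sub>R (p - x))" if "i \<le> k" for i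
        using that
      proof (induction i)
        case 0 then show ?case using v zx by simp
      next
        case (Suc i)
        then have "2 ^ i *\<^sub>R v \<in> disc_dirs \<Omega> (x + (real L ^ i * t) *\<^sub>R (p - x))" by simp
        then have "2 *\<^sub>R (2 ^ i *\<^sub>R v) \<in> disc_dirs \<Omega> (x + (real L * (real L ^ i * t)) *\<^sub>R (p - x))"
          using k(1)[rule_format, OF Suc.prems] t L by (intro doubling x xR) (auto simp: mult.assoc)
        then show ?case by (simp add: mult.assoc)
      qed
      then have 1: "2 ^ k *\<^sub>R v \<in> disc_dirs \<Omega> (x + (real L ^ k * t) *\<^sub>R (p - x))" by simp
      have "norm (x + (real L ^ k * t) *\<^sub>R (p - x)) \<le> norm p + 2 * R'"
      proof -
        have T: "0 \<le> real L ^ k * t" "real L ^ k * t \<le> 1" using k(1) t by auto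
        have "x + (real L ^ k * t) *\<^sub>R (p - x) = p + (1 - real L ^ k * t) *\<^sub>R (x - p)"
          by (simp add: algebra_simps)
        then have "norm (x + (real L ^ k * t) *\<^sub>R (p - x)) \<le> norm p + (1 - real L ^ k * t) * dist x p"
          using norm_triangle_ineq[of p "(1 - real L ^ k * t) *\<^sub>R (x - p)"] T by (simp add: dist_norm)
        also have "\<dots> \<le> norm p + 1 * (2 * R')"
          using T xR by (intro add_left_mono mult_mono) auto
        finally show ?thesis by simp
      qed
      from M(2)[OF this 1] have "2 ^ k * norm v \<le> M" by simp
      moreover have "1 \<le> 2 ^ Suc k * t powr \<alpha>"
      proof -
        have "1 powr \<alpha> \<le> (real L ^ Suc k * t) powr \<alpha>" using k(2) \<alpha> by (intro powr_mono2) auto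
        also have "\<dots> = (real L ^ Suc k) powr \<alpha> * t powr \<alpha>" using t by (simp add: powr_mult)
        also have "(real L ^ Suc k) powr \<alpha> = (real L powr \<alpha>) ^ Suc k"
          by (induction k) (simp_all add: powr_mult)
        finally show ?thesis by (simp add: L\<alpha>)
      qed
      ultimately have "(2 ^ k * norm v) * 1 \<le> M * (2 ^ Suc k * t powr \<alpha>)"
        using M by (intro mult_mono) auto
      then have "norm v \<le> 2 * M * t powr \<alpha>" by (simp add: field_simps)
      also have "\<dots> \<le> 2 * M * ((2 / r) * ?\<delta>) powr \<alpha>"
      proof (intro mult_left_mono powr_mono2)
        have "?\<delta> / r \<le> (2 / r) * ?\<delta>" using r \<delta> by (simp add: field_simps)
        then show "t \<le> (2 / r) * ?\<delta>" using t\<delta> by linarith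
      qed (use t \<alpha> M in auto)
      also have "\<dots> = C * ?\<delta> powr \<alpha>" using r \<delta> by (simp only: C_def powr_mult)
      finally show ?thesis .
    qed
  qed
qed

text \<open>A geodesic is only isometric for the Kobayashi distance; Euclidean continuity comes from
  the boundedness of disc directions at \<open>\<sigma> s\<close>, of which short displacements are
  small multiples.\<close>

lemma geodesic_continuous:
  assumes \<Omega>: "\<Omega> \<in> properly_convex_domains" and \<sigma>: "kobayashi_geodesic \<Omega> I \<sigma>"
  shows "continuous_on I \<sigma>"
  unfolding continuous_on_def
proof
  fix s assume s: "s \<in> I"
  obtain M where M: "M > 0" "\<And>v. v \<in> disc_dirs \<Omega> (\<sigma> s) \<Longrightarrow> norm v \<le> M"
    using disc_dirs_locally_bounded[OF \<Omega>, of "norm (\<sigma> s)"] by (metis order_refl)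
  have bd: "norm (\<sigma> t - \<sigma> s) \<le> 2 * M * (exp (2 * \<bar>s - t\<bar>) - 1)" if t: "t \<in> I" for t
  proof (cases "t = s")
    case False
    define e where "e = exp (2 * \<bar>s - t\<bar>) - 1"
    have e: "e > 0" using False by (simp add: e_def)
    have "(1 / (2 * e)) *\<^sub>R (\<sigma> t - \<sigma> s) \<in> disc_dirs \<Omega> (\<sigma> s)"
    proof (rule disc_dirs_kobayashi)
      show "(1 / (2 * e)) * (exp (2 * kobayashi_dist \<Omega> (\<sigma> s) (\<sigma> t)) - 1) < 1"
        using \<sigma> s t e unfolding kobayashi_geodesic_def by (simp flip: e_def)
    qed (use properly_convexD[OF \<Omega>] \<sigma> s t e in \<open>auto simp: kobayashi_geodesic_def\<close>)
    from M(2)[OF this] have "norm (\<sigma> t - \<sigma> s) / (2 * e) \<le> M" using e by simp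
    then show ?thesis using e by (simp add: e_def[symmetric] divide_le_eq mult_ac)
  qed simp
  have "((\<lambda>t. 2 * M * (exp (2 * \<bar>s - t\<bar>) - 1)) \<longlongrightarrow> 2 * M * (exp (2 * \<bar>s - s\<bar>) - 1)) (at s within I)"
    by (intro tendsto_intros)
  then have "((\<lambda>t. 2 * M * (exp (2 * \<bar>s - t\<bar>) - 1)) \<longlongrightarrow> 0) (at s within I)" by simp
  then have "((\<lambda>t. \<sigma> t - \<sigma> s) \<longlongrightarrow> 0) (at s within I)"
    by (rule Lim_null_comparison[rotated]) (use bd in \<open>auto simp: eventually_at_filter\<close>)
  then show "(\<sigma> \<longlongrightarrow> \<sigma> s) (at s within I)" by (rule LIM_zero_cancel)
qed

text \<open>An abstract path starting at time 0, so that it applies to a geodesic both forwards and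
  backwards from the time at which \<delta> is maximal. The remaining step after the integer times
  is one more term of the geometric series.\<close>

lemma geometric_steps_bound:
  fixes f :: "real \<Rightarrow> 'a::real_normed_vector"
  assumes \<mu>: "0 \<le> \<mu>" "\<mu> < 1" and H: "0 \<le> H" and l: "0 \<le> l"
    and step: "\<And>u u' k. 0 \<le> u \<Longrightarrow> u \<le> u' \<Longrightarrow> u' \<le> l \<Longrightarrow> u' \<le> u + 1 \<Longrightarrow> real k \<le> u \<Longrightarrow>
      norm (f u' - f u) \<le> H * \<mu> ^ k"
  shows "norm (f l - f 0) \<le> H / (1 - \<mu>)"
proof -
  have *: "norm (f (real n) - f 0) \<le> H * (\<Sum>k<n. \<mu> ^ k)" if "real n \<le> l" for n
    using that
  proof (induction n)
    case (Suc n)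
    then have "norm (f (real n) - f 0) \<le> H * (\<Sum>k<n. \<mu> ^ k)" by simp
    moreover have "norm (f (real (Suc n)) - f (real n)) \<le> H * \<mu> ^ n"
      using Suc.prems by (intro step) auto
    ultimately show ?case
      using norm_triangle_ineq[of "f (real (Suc n)) - f (real n)" "f (real n) - f 0"]
      by (simp add: distrib_left)
  qed simp
  define n where "n = nat \<lfloor>l\<rfloor>"
  have n: "real n \<le> l" "l \<le> real n + 1" using l unfolding n_def by linarith+
  have "norm (f l - f (real n)) \<le> H * \<mu> ^ n" using n by (intro step) auto
  with *[OF n(1)] have "norm (f l - f 0) \<le> H * (\<Sum>k<Suc n. \<mu> ^ k)"
    using norm_triangle_ineq[of "f l - f (real n)" "f (real n) - f 0"] by (simp add: distrib_left)
  also have "(\<Sum>k<Suc n. \<mu> ^ k) \<le> 1 / (1 - \<mu>)"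
    using \<mu> by (subst sum_gp_strict) (auto simp: divide_right_mono)
  finally show ?thesis using H by (simp add: mult_left_mono)
qed

section \<open>Visibility of geodesics\<close>

lemma geodesic_visibility:
  fixes \<Omega> :: "(complex ^ 'd) set"
  assumes \<Omega>: "\<Omega> \<in> properly_convex_domains"
    and simple: "\<And>D. D \<in> affine_orbit_closure \<Omega> \<Longrightarrow> simple_boundary D"
    and \<epsilon>: "\<epsilon> > 0"
  obtains \<kappa> where "\<kappa> > 0"
    "\<And>a b \<sigma>. a \<le> b \<Longrightarrow> kobayashi_geodesic \<Omega> {a..b} \<sigma> \<Longrightarrow> \<sigma> ` {a..b} \<subseteq> cball 0 R \<Longrightarrow>
      \<epsilon> \<le> dist (\<sigma> a) (\<sigma> b) \<Longrightarrow> \<exists>t\<in>{a..b}. \<kappa> \<le> bdry_dist \<Omega> (\<sigma> t)"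
proof -
  note op = properly_convexD(1)[OF \<Omega>] and cv = properly_convexD(2)[OF \<Omega>]
    and ne = properly_convex_not_UNIV[OF \<Omega>]
  obtain p where p: "p \<in> \<Omega>" using properly_convexD(3)[OF \<Omega>] by auto
  obtain y0 where y0: "y0 \<in> - \<Omega>" using ne by blast
  obtain r where r: "r > 0" "ball p r \<subseteq> \<Omega>" using op p open_contains_ball by blast
  obtain C \<alpha> where C: "C > 0" and \<alpha>: "\<alpha> > 0" and hoelder:
    "\<And>z v. z \<in> \<Omega> \<Longrightarrow> norm z \<le> R \<Longrightarrow> v \<in> disc_dirs \<Omega> z \<Longrightarrow> norm v \<le> C * bdry_dist \<Omega> z powr \<alpha>"
    using disc_dirs_Hoelder[OF \<Omega> simple, of R] by blast
  define R' where "R' = \<bar>R\<bar> + norm p + r"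
  have R': "R' > 0" "r \<le> R'" using r by (auto simp: R'_def intro: add_nonneg_pos)
  define l where "l = 1 - r / (3 * R')"
  have l: "0 < l" "l < 1" using r R' by (auto simp: l_def field_simps)
  \<comment> \<open>\<open>3 * R'\<close> serves the chain estimate, and
    \<open>\<bar>R\<bar> + norm y0\<close> bounds \<delta> outright for \<open>k \<le> 2\<close>.
    Dividing by \<open>l ^ 2\<close> provides the two spare powers that allow
    \<open>j = k - 2\<close>.\<close>
  define E where "E = (3 * R' + (\<bar>R\<bar> + norm y0)) / l ^ 2"
  have E: "E > 0" unfolding E_def using R' l by (intro divide_pos_pos add_pos_nonneg) auto
  define \<mu> where "\<mu> = l powr (\<alpha> / 2)"
  have \<mu>: "0 < \<mu>" "\<mu> < 1" using l \<alpha> powr_less_mono2[of "\<alpha> / 2" l 1] by (auto simp: \<mu>_def)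
  \<comment> \<open>9 bounds \<open>exp 2\<close>, the growth factor over a unit of time.\<close>
  define Q where "Q = 9 * C * E powr (\<alpha> / 2)"
  have Q: "Q > 0" using C E by (simp add: Q_def)
  \<comment> \<open>Solves \<open>\<epsilon> = 2 * Q * \<kappa> powr (\<alpha> / 2) / (1 -
    \<mu>)\<close>, whose right side is the bound for both halves of the geodesic together.\<close>
  define \<kappa> where "\<kappa> = (\<epsilon> * (1 - \<mu>) / (2 * Q)) powr (2 / \<alpha>)"
  show thesis
  proof (rule that)
    show "\<kappa> > 0" using \<epsilon> \<mu> Q by (simp add: \<kappa>_def)
    fix a b :: real and \<sigma> :: "real \<Rightarrow> complex ^ 'd"
    assume ab: "a \<le> b" and \<sigma>: "kobayashi_geodesic \<Omega> {a..b} \<sigma>" and \<sigma>R: "\<sigma> ` {a..b} \<subseteq> cball 0 R"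
      and far: "\<epsilon> \<le> dist (\<sigma> a) (\<sigma> b)"
    define \<delta> where "\<delta> t = bdry_dist \<Omega> (\<sigma> t)" for t
    have \<sigma>\<Omega>: "\<sigma> t \<in> \<Omega>" if "t \<in> {a..b}" for t using \<sigma> that by (auto simp: kobayashi_geodesic_def)
    have K: "kobayashi_dist \<Omega> (\<sigma> s) (\<sigma> t) = \<bar>s - t\<bar>" if "s \<in> {a..b}" "t \<in> {a..b}" for s t
      using \<sigma> that by (auto simp: kobayashi_geodesic_def)
    have \<sigma>n: "norm (\<sigma> t) \<le> R" if "t \<in> {a..b}" for t using \<sigma>R that by (auto simp: image_subset_iff)
    have \<delta>pos: "\<delta> t > 0" if "t \<in> {a..b}" for t
      unfolding \<delta>_def by (rule bdry_dist_pos[OF op ne \<sigma>\<Omega>[OF that]])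
    have "continuous_on {a..b} \<delta>"
      unfolding \<delta>_def by (intro continuous_intros geodesic_continuous[OF \<Omega> \<sigma>])
    then obtain t0 where t0: "t0 \<in> {a..b}" and max: "\<And>t. t \<in> {a..b} \<Longrightarrow> \<delta> t \<le> \<delta> t0"
      using continuous_attains_sup[of "{a..b}" \<delta>] ab by auto
    \<comment> \<open>If \<delta> were larger at \<open>t\<close>, it would be larger at the maximum
      \<open>t0\<close> as well, and chains of \<open>j + 1\<close> discs would join
      \<open>p\<close> to both points. Then \<open>\<bar>t - t0\<bar>\<close> would be at most
      \<open>j + 1\<close>, less than \<open>k\<close>.\<close>
    have decay: "\<delta> t \<le> E * l ^ k" if t: "t \<in> {a..b}" and k: "real k \<le> \<bar>t - t0\<bar>" for t k
    proof (cases "k \<le> 2")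
      case True
      have "\<delta> t \<le> dist (\<sigma> t) y0" unfolding \<delta>_def by (rule infdist_le[OF y0])
      also have "\<dots> \<le> \<bar>R\<bar> + norm y0"
        using norm_triangle_ineq4[of "\<sigma> t" y0] \<sigma>n[OF t] by (simp add: dist_norm)
      also have "\<dots> \<le> E * l ^ 2" using l R' by (simp add: E_def)
      also have "\<dots> \<le> E * l ^ k" using l E True by (intro mult_left_mono power_decreasing) auto
      finally show ?thesis .
    next
      case False
      define j where "j = k - 2"
      have k_j: "k = j + 2" using False by (simp add: j_def)
      show ?thesis
      proof (rule ccontr)
        assume "\<not> ?thesis"
        then have "E * l ^ k < \<delta> t" by simp
        moreover have "E * l ^ k = (3 * R' + (\<bar>R\<bar> + norm y0)) * l ^ j"
          using l by (simp add: E_def k_j power_add power2_eq_square)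
        moreover have "3 * (l ^ j * R') \<le> (3 * R' + (\<bar>R\<bar> + norm y0)) * l ^ j"
          using l by (simp add: algebra_simps)
        ultimately have j: "3 * (l ^ j * R') \<le> \<delta> t" by linarith
        have chain: "\<exists>s \<le> (real j + 1) / 2. disc_chain \<Omega> p (\<sigma> u) s"
          if u: "u \<in> {a..b}" and "\<delta> t \<le> \<delta> u" for u
        proof (rule disc_chain_to_point[OF op cv r])
          show "dist p (\<sigma> u) \<le> R'"
            using norm_triangle_ineq4[of p "\<sigma> u"] \<sigma>n[OF u] r by (simp add: R'_def dist_norm)
          show "0 < \<delta> u" by (rule \<delta>pos[OF u])
          show "ball (\<sigma> u) (\<delta> u) \<subseteq> \<Omega>" unfolding \<delta>_def by (rule ball_bdry_dist)
          show "3 * ((1 - r / (3 * R')) ^ j * R') \<le> \<delta> u" using j that unfolding l_def by linarith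
        qed (rule R')
        obtain s1 s2 where s: "s1 \<le> (real j + 1) / 2" "disc_chain \<Omega> p (\<sigma> t0) s1"
            "s2 \<le> (real j + 1) / 2" "disc_chain \<Omega> p (\<sigma> t) s2"
          using chain[OF t0 max[OF t]] chain[OF t order_refl] by blast
        have "\<bar>t0 - t\<bar> \<le> s1 + s2"
          using kobayashi_dist_le[OF disc_chain_trans[OF s(4) disc_chain_sym[OF s(2)]]] K[OF t0 t] by simp
        then show False using s(1,3) k k_j by simp
      qed
    qed
    define H where "H = Q * \<delta> t0 powr (\<alpha> / 2)"
    have H: "H \<ge> 0" using Q by (simp add: H_def)
    have step: "norm (\<sigma> t' - \<sigma> t) \<le> H * \<mu> ^ k"
      if t: "t \<in> {a..b}" and t': "t' \<in> {a..b}" and tt': "\<bar>t - t'\<bar> \<le> 1" and k: "real k \<le> \<bar>t - t0\<bar>" for t t' k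
    proof -
      have "exp (2 * \<bar>t - t'\<bar>) \<le> exp (1 + 1 :: real)" using tt' by simp
      also have "\<dots> \<le> 3 * 3" unfolding exp_add using exp_le by (intro mult_mono) auto
      finally have "(1/9) *\<^sub>R (\<sigma> t' - \<sigma> t) \<in> disc_dirs \<Omega> (\<sigma> t)"
        by (intro disc_dirs_kobayashi[OF op cv \<sigma>\<Omega>[OF t] \<sigma>\<Omega>[OF t']]) (simp_all add: K[OF t t'])
      from hoelder[OF \<sigma>\<Omega>[OF t] \<sigma>n[OF t] this]
      have "norm (\<sigma> t' - \<sigma> t) \<le> 9 * C * \<delta> t powr \<alpha>" by (simp add: \<delta>_def)
      also have "\<delta> t powr \<alpha> = (\<delta> t * \<delta> t) powr (\<alpha> / 2)"
        using \<delta>pos[OF t] by (simp add: powr_mult flip: powr_add)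
      also have "\<dots> \<le> (\<delta> t0 * (E * l ^ k)) powr (\<alpha> / 2)"
        using \<delta>pos[OF t] max[OF t] decay[OF t k] \<alpha> by (intro powr_mono2 mult_mono) auto
      also have "\<dots> = \<delta> t0 powr (\<alpha> / 2) * (E powr (\<alpha> / 2) * \<mu> ^ k)"
      proof -
        have "(l ^ k) powr (\<alpha> / 2) = \<mu> ^ k"
          using l by (simp add: \<mu>_def powr_powr mult.commute flip: powr_realpow)
        then show ?thesis using \<delta>pos[OF t0] E l by (simp add: powr_mult)
      qed
      finally show ?thesis using C by (simp add: H_def Q_def mult_ac)
    qed
    have "norm (\<sigma> (t0 + (b - t0)) - \<sigma> (t0 + 0)) \<le> H / (1 - \<mu>)"
      by (rule geometric_steps_bound[where f = "\<lambda>u. \<sigma> (t0 + u)"])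
        (use \<mu> H t0 in \<open>auto intro!: step\<close>)
    moreover have "norm (\<sigma> (t0 - (t0 - a)) - \<sigma> (t0 - 0)) \<le> H / (1 - \<mu>)"
      by (rule geometric_steps_bound[where f = "\<lambda>u. \<sigma> (t0 - u)"])
        (use \<mu> H t0 in \<open>auto intro!: step\<close>)
    ultimately have "dist (\<sigma> a) (\<sigma> b) \<le> 2 * (H / (1 - \<mu>))"
      using dist_triangle[of "\<sigma> a" "\<sigma> b" "\<sigma> t0"] by (simp add: dist_norm norm_minus_commute)
    with far have "\<epsilon> \<le> 2 * (H / (1 - \<mu>))" by linarith
    then have "\<epsilon> * (1 - \<mu>) / (2 * Q) \<le> \<delta> t0 powr (\<alpha> / 2)"
      using \<mu> Q by (simp add: H_def field_simps)
    then have "\<kappa> \<le> (\<delta> t0 powr (\<alpha> / 2)) powr (2 / \<alpha>)"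
      unfolding \<kappa>_def using \<epsilon> \<mu> Q \<alpha> by (intro powr_mono2) auto
    also have "\<dots> = \<delta> t0" using \<alpha> \<delta>pos[OF t0] by (simp add: powr_powr)
    finally show "\<exists>t\<in>{a..b}. \<kappa> \<le> bdry_dist \<Omega> (\<sigma> t)" using t0 by (auto simp: \<delta>_def)
  qed
qed

text \<open>Visibility requires a bounded region, so each geodesic is stopped when it first reaches
  distance \<rho> from \<open>x\<close>; its end points are then still at least
  \<open>\<rho> / 2\<close> apart.\<close>

lemma geodesics_meet_interior:
  fixes \<Omega> :: "(complex ^ 'd) set"
  assumes \<Omega>: "\<Omega> \<in> properly_convex_domains"
    and simple: "\<And>D. D \<in> affine_orbit_closure \<Omega> \<Longrightarrow> simple_boundary D"
    and ab: "\<And>n. a n \<le> b n"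
    and \<sigma>: "\<And>n. kobayashi_geodesic \<Omega> {a n..b n} (\<sigma> n)"
    and x: "(\<lambda>n. \<sigma> n (a n)) \<longlonglongrightarrow> x"
    and \<rho>: "\<rho> > 0" "\<forall>\<^sub>F n in sequentially. \<rho> \<le> dist (\<sigma> n (b n)) x"
  shows "\<exists>(n :: nat \<Rightarrow> nat) T. \<exists>p\<in>\<Omega>.
    filterlim n at_top sequentially \<and> (\<forall>j. T j \<in> {a (n j)..b (n j)}) \<and>
    (\<lambda>j. \<sigma> (n j) (T j)) \<longlonglongrightarrow> p"
proof -
  define R where "R = norm x + \<rho>"
  obtain \<kappa> where \<kappa>: "\<kappa> > 0" and vis:
    "\<And>a b \<sigma>. a \<le> b \<Longrightarrow> kobayashi_geodesic \<Omega> {a..b} \<sigma> \<Longrightarrow> \<sigma> ` {a..b} \<subseteq> cball 0 R \<Longrightarrow>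
      \<rho> / 2 \<le> dist (\<sigma> a) (\<sigma> b) \<Longrightarrow> \<exists>t\<in>{a..b}. \<kappa> \<le> bdry_dist \<Omega> (\<sigma> t)"
  proof (rule geodesic_visibility[OF \<Omega> simple])
    show "\<rho> / 2 > 0" using \<rho> by simp
  qed (use that in blast)+
  have "\<forall>\<^sub>F n in sequentially. dist (\<sigma> n (a n)) x < \<rho> / 2"
    using x \<rho> by (intro tendstoD) auto
  with \<rho>(2) obtain N where N: "\<And>n. n \<ge> N \<Longrightarrow> dist (\<sigma> n (a n)) x < \<rho> / 2 \<and> \<rho> \<le> dist (\<sigma> n (b n)) x"
    using eventually_conj unfolding eventually_sequentially by (metis (mono_tags, lifting) le_trans nat_le_linear)
  have "\<exists>t\<in>{a n..b n}. \<kappa> \<le> bdry_dist \<Omega> (\<sigma> n t) \<and> \<sigma> n t \<in> cball 0 R" if n: "n \<ge> N" for n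
  proof -
    define f where "f t = dist (\<sigma> n t) x" for t
    have cf: "continuous_on {a n..b n} f"
      unfolding f_def by (intro continuous_intros geodesic_continuous[OF \<Omega> \<sigma>])
    have fa: "f (a n) < \<rho> / 2" and fb: "\<rho> \<le> f (b n)" using N[OF n] by (auto simp: f_def)
    define Z where "Z = {t \<in> {a n..b n}. f t = \<rho>}"
    have "closed Z"
      unfolding Z_def by (rule continuous_closed_preimage_constant[OF cf]) simp
    moreover have "bounded Z" by (rule bounded_subset[OF bounded_closed_interval]) (auto simp: Z_def)
    ultimately have cZ: "compact Z" by (simp add: compact_eq_bounded_closed)
    have "Z \<noteq> {}"
      using IVT'[of f "a n" \<rho> "b n"] fa fb ab[of n] cf \<rho> by (auto simp: Z_def)
    then obtain c where c: "c \<in> Z" and cmin: "\<And>t. t \<in> Z \<Longrightarrow> c \<le> t"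
      using compact_attains_inf[OF cZ] by blast
    have cab: "a n \<le> c" "c \<le> b n" "f c = \<rho>" using c by (auto simp: Z_def)
    have fle: "f t \<le> \<rho>" if t: "t \<in> {a n..c}" for t
    proof (rule ccontr)
      assume "\<not> ?thesis"
      then have gt: "f t > \<rho>" by simp
      have "continuous_on {a n..t} f" using cf t cab by (auto intro: continuous_on_subset)
      then obtain s where s: "a n \<le> s" "s \<le> t" "f s = \<rho>"
        using IVT'[of f "a n" \<rho> t] fa gt t \<rho> by auto
      then have "c \<le> s" using t cab by (intro cmin) (auto simp: Z_def)
      then have "s = t" using s t by auto
      then show False using s gt by simp
    qed
    have sub: "\<sigma> n t \<in> cball 0 R" if "t \<in> {a n..c}" for t
      using norm_triangle_ineq[of "\<sigma> n t - x" x] fle[OF that] by (simp add: f_def R_def dist_norm)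
    have "kobayashi_geodesic \<Omega> {a n..c} (\<sigma> n)"
      using \<sigma>[of n] cab by (auto simp: kobayashi_geodesic_def image_subset_iff)
    moreover have "\<rho> / 2 \<le> dist (\<sigma> n (a n)) (\<sigma> n c)"
      using dist_triangle[of "\<sigma> n c" x "\<sigma> n (a n)"] fa cab by (simp add: f_def dist_commute)
    ultimately obtain t where "t \<in> {a n..c}" "\<kappa> \<le> bdry_dist \<Omega> (\<sigma> n t)"
      using vis[OF cab(1)] sub by blast
    then show ?thesis using sub cab by (intro bexI[of _ t]) auto
  qed
  then obtain T where T: "\<And>n. n \<ge> N \<Longrightarrow> T n \<in> {a n..b n} \<and> \<kappa> \<le> bdry_dist \<Omega> (\<sigma> n (T n)) \<and> \<sigma> n (T n) \<in> cball 0 R"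
    by metis
  \<comment> \<open>Since \<open>bdry_dist\<close> vanishes off \<Omega>, this compact set lies
    inside \<Omega>.\<close>
  define G where "G = {z. \<kappa> \<le> bdry_dist \<Omega> z} \<inter> cball 0 R"
  have "closed {z. \<kappa> \<le> bdry_dist \<Omega> z}" by (intro closed_Collect_le continuous_intros)
  then have "compact G" unfolding G_def by (intro closed_Int_compact) auto
  moreover have "\<forall>n. \<sigma> (n + N) (T (n + N)) \<in> G" using T by (simp add: G_def)
  ultimately obtain p k where p: "p \<in> G" and k: "strict_mono (k :: nat \<Rightarrow> nat)"
    and lim: "((\<lambda>n. \<sigma> (n + N) (T (n + N))) \<circ> k) \<longlonglongrightarrow> p"
    unfolding compact_def by meson
  have "p \<in> \<Omega>"
  proof (rule ccontr)
    assume "p \<notin> \<Omega>"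
    then have "bdry_dist \<Omega> p = 0" by simp
    then show False using p \<kappa> by (simp add: G_def)
  qed
  moreover have "filterlim (\<lambda>j. k j + N) at_top sequentially"
    using filterlim_subseq[OF k] by (rule filterlim_at_top_mono) simp
  ultimately show ?thesis
    using lim T by (intro exI[of _ "\<lambda>j. k j + N"] exI[of _ "\<lambda>j. T (k j + N)"] bexI[of _ p]) (auto simp: comp_def)
qed

section \<open>Ends\<close>

lemma limitin_end_compactification_InlD:
  fixes f :: "nat \<Rightarrow> 'a::topological_space"
  assumes "limitin (end_compactification X) (\<lambda>n. Inl (f n)) (Inl x) sequentially"
  shows "f \<longlonglongrightarrow> x"
proof (rule topological_tendstoI)
  fix U assume U: "open U" "x \<in> U"
  have "Inl x \<in> topspace (end_compactification X)" using assms by (simp add: limitin_def)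
  then have "x \<in> X" by (auto simp: topspace_end_compactification)
  have "openin (top_of_set X) (X \<inter> U)" using U by (simp add: openin_open_Int)
  then have "openin (end_compactification X) (Inl ` (X \<inter> U))"
    unfolding end_compactification_def by (intro topology_generated_by_Basis) blast
  then have "\<forall>\<^sub>F n in sequentially. (Inl (f n) :: 'a + ('a set \<Rightarrow> 'a set)) \<in> Inl ` (X \<inter> U)"
    by (rule limitinD[OF assms]) (use U \<open>x \<in> X\<close> in blast)
  then show "\<forall>\<^sub>F n in sequentially. f n \<in> U" by eventually_elim auto
qed

lemma space_ends_component:
  assumes "e \<in> space_ends X" "compact K" "K \<subseteq> X"
  shows "e K \<in> components (X - K)"
  using assms unfolding space_ends_def by (auto dest: PiE_mem)

lemma limitin_end_compactification_InrD:
  fixes f :: "nat \<Rightarrow> 'a::topological_space"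
  assumes lim: "limitin (end_compactification X) (\<lambda>n. Inl (f n)) (Inr e) sequentially"
  shows "e \<in> space_ends X"
    and "compact K \<Longrightarrow> K \<subseteq> X \<Longrightarrow> \<forall>\<^sub>F n in sequentially. f n \<in> e K"
proof -
  have "Inr e \<in> topspace (end_compactification X)" using assms by (simp add: limitin_def)
  then show e: "e \<in> space_ends X" by (auto simp: topspace_end_compactification)
  assume K: "compact K" "K \<subseteq> X"
  let ?B = "Inl ` e K \<union> Inr ` {e' \<in> space_ends X. e' K = e K} :: ('a + ('a set \<Rightarrow> 'a set)) set"
  have "openin (end_compactification X) ?B"
    unfolding end_compactification_def
    by (intro topology_generated_by_Basis UnI2 CollectI exI[of _ K] exI[of _ "e K"] conjI refl K
        space_ends_component[OF e])
  moreover have "Inr e \<in> ?B" using e by blast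
  ultimately have "\<forall>\<^sub>F n in sequentially. Inl (f n) \<in> ?B"
    by (rule limitinD[OF lim])
  then show "\<forall>\<^sub>F n in sequentially. f n \<in> e K" by eventually_elim auto
qed

lemma geodesics_from_point_meet_interior:
  fixes \<Omega> :: "(complex ^ 'd) set"
  assumes \<Omega>: "\<Omega> \<in> properly_convex_domains"
    and simple: "\<And>D. D \<in> affine_orbit_closure \<Omega> \<Longrightarrow> simple_boundary D"
    and ab: "\<And>n. a n \<le> b n"
    and \<sigma>: "\<And>n. kobayashi_geodesic \<Omega> {a n..b n} (\<sigma> n)"
    and x: "(\<lambda>n. \<sigma> n (a n)) \<longlonglongrightarrow> x"
    and \<eta>: "limitin (end_compactification (closure \<Omega>)) (\<lambda>n. Inl (\<sigma> n (b n))) \<eta> sequentially"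
    and neq: "\<eta> \<noteq> Inl x"
  shows "\<exists>(n :: nat \<Rightarrow> nat) T. \<exists>p\<in>\<Omega>.
    filterlim n at_top sequentially \<and> (\<forall>j. T j \<in> {a (n j)..b (n j)}) \<and>
    (\<lambda>j. \<sigma> (n j) (T j)) \<longlonglongrightarrow> p"
proof (cases \<eta>)
  case (Inl y)
  define \<rho> where "\<rho> = dist x y / 2"
  have \<rho>: "\<rho> > 0" using neq Inl by (auto simp: \<rho>_def)
  have "(\<lambda>n. \<sigma> n (b n)) \<longlonglongrightarrow> y"
    using \<eta> unfolding Inl by (rule limitin_end_compactification_InlD)
  then have "\<forall>\<^sub>F n in sequentially. dist (\<sigma> n (b n)) y < \<rho>" using \<rho> by (rule tendstoD)
  then have far: "\<forall>\<^sub>F n in sequentially. \<rho> \<le> dist (\<sigma> n (b n)) x"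
  proof eventually_elim
    case (elim n)
    then show ?case using dist_triangle[of x y "\<sigma> n (b n)"] by (simp add: \<rho>_def dist_commute)
  qed
  show ?thesis by (rule geodesics_meet_interior[of \<Omega> a b \<sigma> x \<rho>]) (fact \<Omega> simple ab \<sigma> x \<rho> far)+
next
  case (Inr e)
  note lim = \<eta>[unfolded Inr]
  \<comment> \<open>A sequence converging to an end leaves this compact set, hence eventually keeps
    distance 1 from \<open>x\<close>.\<close>
  let ?K = "closure \<Omega> \<inter> cball x 1"
  have K: "compact ?K" "?K \<subseteq> closure \<Omega>" by (auto intro: closed_Int_compact)
  have "e ?K \<subseteq> closure \<Omega> - ?K"
    by (rule in_components_subset[OF space_ends_component[OF limitin_end_compactification_InrD(1)[OF lim] K]])
  with limitin_end_compactification_InrD(2)[OF lim K]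
  have far: "\<forall>\<^sub>F n in sequentially. 1 \<le> dist (\<sigma> n (b n)) x"
    by (auto simp: dist_commute elim!: eventually_mono)
  show ?thesis
    by (rule geodesics_meet_interior[of \<Omega> a b \<sigma> x 1]) (fact \<Omega> simple ab \<sigma> x zero_less_one far)+
qed

text \<open>Ends are extensional functions on the compact subsets of \<open>X\<close>, so two
  distinct ones differ at such a subset.\<close>

lemma space_ends_separated:
  assumes e: "e \<in> space_ends X" and e': "e' \<in> space_ends X" and "e \<noteq> e'"
  obtains K where "compact K" "K \<subseteq> X" "e K \<noteq> e' K"
proof (rule ccontr)
  assume no: "\<not> thesis"
  have "e \<in> (\<Pi>\<^sub>E K\<in>{K. compact K \<and> K \<subseteq> X}. components (X - K))"
    "e' \<in> (\<Pi>\<^sub>E K\<in>{K. compact K \<and> K \<subseteq> X}. components (X - K))"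
    using e e' by (auto simp: space_ends_def)
  then have "e = e'" by (rule PiE_ext) (use no that in blast)
  then show False using \<open>e \<noteq> e'\<close> by simp
qed

theorem proposition8p1:
  fixes \<Omega> :: "(complex ^ 'd) set"
    and \<sigma> :: "nat \<Rightarrow> real \<Rightarrow> complex ^ 'd"
    and a b :: "nat \<Rightarrow> real"
    and \<xi> \<eta> :: "complex ^ 'd + ((complex ^ 'd) set \<Rightarrow> (complex ^ 'd) set)"
  assumes "\<Omega> \<in> properly_convex_domains"
    and "\<And>D. D \<in> affine_orbit_closure \<Omega> \<Longrightarrow> simple_boundary D"
    and "\<And>n. a n \<le> b n"
    and "\<And>n. kobayashi_geodesic \<Omega> {a n..b n} (\<sigma> n)"
    and "limitin (end_compactification (closure \<Omega>)) (\<lambda>n. Inl (\<sigma> n (a n))) \<xi> sequentially"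
    and "limitin (end_compactification (closure \<Omega>)) (\<lambda>n. Inl (\<sigma> n (b n))) \<eta> sequentially"
    and "\<xi> \<noteq> \<eta>"
  shows "\<exists>(n :: nat \<Rightarrow> nat) T. \<exists>p\<in>\<Omega>.
    filterlim n at_top sequentially \<and> (\<forall>j. T j \<in> {a (n j)..b (n j)}) \<and>
    (\<lambda>j. \<sigma> (n j) (T j)) \<longlonglongrightarrow> p"
proof -
  note \<Omega> = assms(1) and simple = assms(2) and ab = assms(3) and \<sigma> = assms(4)
  show ?thesis
  proof (cases \<xi>)
    case (Inl x)
    have x: "(\<lambda>n. \<sigma> n (a n)) \<longlonglongrightarrow> x"
      by (rule limitin_end_compactification_InlD[OF assms(5)[unfolded Inl]])
    have neq: "\<eta> \<noteq> Inl x" using Inl assms(7) by simp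
    show ?thesis
      by (rule geodesics_from_point_meet_interior[of \<Omega> a b \<sigma> x \<eta>])
        (fact \<Omega> simple ab \<sigma> x assms(6) neq)+
  next
    case (Inr e)
    note \<xi> = assms(5)[unfolded Inr]
    show ?thesis
    proof (cases \<eta>)
      case (Inl y)
      \<comment> \<open>Reversing time exchanges the end points; the double negation is the reversed
        geodesic at its starting time \<open>- b n\<close>.\<close>
      have y: "(\<lambda>n. \<sigma> n (- (- b n))) \<longlonglongrightarrow> y"
        using limitin_end_compactification_InlD[OF assms(6)[unfolded Inl]] by simp
      have "\<exists>(n :: nat \<Rightarrow> nat) T. \<exists>p\<in>\<Omega>.
          filterlim n at_top sequentially \<and> (\<forall>j. T j \<in> {- b (n j)..- a (n j)}) \<and>
          (\<lambda>j. \<sigma> (n j) (- T j)) \<longlonglongrightarrow> p"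
      proof (rule geodesics_from_point_meet_interior[of \<Omega> "\<lambda>n. - b n" "\<lambda>n. - a n" "\<lambda>n t. \<sigma> n (- t)",
            OF \<Omega> simple])
        show "- b n \<le> - a n" for n using ab by simp
        show "kobayashi_geodesic \<Omega> {- b n..- a n} (\<lambda>t. \<sigma> n (- t))" for n
          using \<sigma>[of n] by (auto simp: kobayashi_geodesic_def image_subset_iff)
        show "(\<lambda>n. \<sigma> n (- (- b n))) \<longlonglongrightarrow> y" by (rule y)
        show "limitin (end_compactification (closure \<Omega>)) (\<lambda>n. Inl (\<sigma> n (- (- a n)))) \<xi> sequentially"
          using assms(5) by simp
        show "\<xi> \<noteq> Inl y" using Inl assms(7) by auto
      qed
      then obtain n T p where "p \<in> \<Omega>" "filterlim n at_top sequentially"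
        "\<forall>j. T j \<in> {- b (n j)..- a (n j)}" "(\<lambda>j. \<sigma> (n j) (- T j)) \<longlonglongrightarrow> p" by blast
      then show ?thesis
        by (intro exI[of _ n] exI[of _ "\<lambda>j. - T j"] bexI[of _ p])
          (auto simp: minus_le_iff le_minus_iff)
    next
      case (Inr e')
      note \<eta> = assms(6)[unfolded Inr]
      have ends: "e \<in> space_ends (closure \<Omega>)" "e' \<in> space_ends (closure \<Omega>)"
        by (rule limitin_end_compactification_InrD(1)[OF \<xi>] limitin_end_compactification_InrD(1)[OF \<eta>])+
      have "e \<noteq> e'" using assms(7) \<open>\<xi> = Inr e\<close> Inr by auto
      with ends obtain K where K: "compact K" "K \<subseteq> closure \<Omega>" and neq: "e K \<noteq> e' K"
        by (rule space_ends_separated)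
      have comp: "e K \<in> components (closure \<Omega> - K)" "e' K \<in> components (closure \<Omega> - K)"
        using space_ends_component ends K by blast+
      have "\<forall>\<^sub>F n in sequentially. \<sigma> n (a n) \<in> e K \<and> \<sigma> n (b n) \<in> e' K"
        using limitin_end_compactification_InrD(2)[OF \<xi> K] limitin_end_compactification_InrD(2)[OF \<eta> K]
        by (rule eventually_conj)
      then obtain N where N: "\<And>n. n \<ge> N \<Longrightarrow> \<sigma> n (a n) \<in> e K \<and> \<sigma> n (b n) \<in> e' K"
        by (auto simp: eventually_sequentially)
      \<comment> \<open>Otherwise the image would be a connected subset of
        \<open>closure \<Omega> - K\<close> meeting two different components.\<close>
      have "\<exists>c\<in>{a n..b n}. \<sigma> n c \<in> K" if n: "n \<ge> N" for n
      proof (rule ccontr)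
        assume no: "\<not> ?thesis"
        let ?I = "\<sigma> n ` {a n..b n}"
        have con: "connected ?I"
          by (intro connected_continuous_image geodesic_continuous[OF \<Omega> \<sigma>]) simp
        have sub: "?I \<subseteq> closure \<Omega> - K"
          using \<sigma>[of n] no closure_subset[of \<Omega>] by (auto simp: kobayashi_geodesic_def)
        have ends_in: "\<sigma> n (a n) \<in> ?I" "\<sigma> n (b n) \<in> ?I" using ab[of n] by auto
        have "?I \<subseteq> e K"
          by (rule components_maximal[OF comp(1) con sub]) (use N[OF n] ends_in in blast)
        then have "e K \<inter> e' K \<noteq> {}" using N[OF n] ends_in by blast
        then show False using components_nonoverlap[OF comp] neq by blast
      qed
      then obtain c where c: "\<And>n. n \<ge> N \<Longrightarrow> c n \<in> {a n..b n} \<and> \<sigma> n (c n) \<in> K" by metis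
      then have "\<forall>n. \<sigma> (n + N) (c (n + N)) \<in> K" by simp
      then obtain x k where k: "strict_mono (k :: nat \<Rightarrow> nat)"
        and x: "((\<lambda>n. \<sigma> (n + N) (c (n + N))) \<circ> k) \<longlonglongrightarrow> x"
        using K(1) unfolding compact_def by meson
      \<comment> \<open>Restarting the geodesics at the times \<open>c (m j)\<close> spent in
        \<open>K\<close> reduces the case of two ends to that of a finite limit and an end.\<close>
      define m where "m j = k j + N" for j
      have m: "strict_mono m" using k by (simp add: m_def strict_mono_def)
      have cm: "c (m j) \<in> {a (m j)..b (m j)}" for j using c[of "m j"] by (simp add: m_def)
      have "\<exists>(n :: nat \<Rightarrow> nat) T. \<exists>p\<in>\<Omega>.
          filterlim n at_top sequentially \<and> (\<forall>j. T j \<in> {c (m (n j))..b (m (n j))}) \<and>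
          (\<lambda>j. \<sigma> (m (n j)) (T j)) \<longlonglongrightarrow> p"
      proof (rule geodesics_from_point_meet_interior[of \<Omega> "\<lambda>n. c (m n)" "\<lambda>n. b (m n)" "\<lambda>n. \<sigma> (m n)",
            OF \<Omega> simple])
        show "c (m n) \<le> b (m n)" for n using cm[of n] by simp
        show "kobayashi_geodesic \<Omega> {c (m n)..b (m n)} (\<sigma> (m n))" for n
          using \<sigma>[of "m n"] cm[of n] by (auto simp: kobayashi_geodesic_def image_subset_iff)
        show "(\<lambda>n. \<sigma> (m n) (c (m n))) \<longlonglongrightarrow> x" using x by (simp add: m_def comp_def)
        show "limitin (end_compactification (closure \<Omega>)) (\<lambda>n. Inl (\<sigma> (m n) (b (m n)))) \<eta> sequentially"
          using limitin_subsequence[OF m assms(6)] by (simp add: comp_def)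
        show "\<eta> \<noteq> Inl x" using Inr by simp
      qed
      then obtain n T p where np: "p \<in> \<Omega>" "filterlim n at_top sequentially"
        "\<forall>j. T j \<in> {c (m (n j))..b (m (n j))}" "(\<lambda>j. \<sigma> (m (n j)) (T j)) \<longlonglongrightarrow> p" by blast
      have "filterlim (\<lambda>j. m (n j)) at_top sequentially"
        by (rule filterlim_compose[OF filterlim_subseq[OF m] np(2)])
      moreover have "T j \<in> {a (m (n j))..b (m (n j))}" for j
        using np(3)[rule_format, of j] cm[of "n j"] by auto
      ultimately show ?thesis
        using np(1,4) by (intro exI[of _ "\<lambda>j. m (n j)"] exI[of _ T] bexI[of _ p]) auto
    qed
  qed
qed

end
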